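(* Suppose $\mathcal M$ is a finite ergodic lazy Markov chain on state space $V$ with kernel $P$, stationary distribution $\pi$ and edge set $E$, and $\Gamma$ is a set of paths $\gamma_{xy}$ between every pair of distinct vertices $x,y\in V$. Define $$\rho_e=\max_{e\in E}\frac{1}{Q(e)}\sum_{\gamma_{xy}\ni e}\pi(x)\pi(y)\qquad\text{and}\qquad\rho_v=\max_{v\in V}\frac{1}{\pi(v)}\sum_{\gamma_{xy}\ni v}\pi(x)\pi(y).$$ Then $$1-\mathcal C_{\sqrt{a(1-a)}}\ge 2\,\frac{\rho_v}{\rho_e}\left(1-\sqrt{1-1/4\rho_v^2}\right)\ge\frac{1}{4\,\rho_v\,\rho_e}$$ and $$\tau(\epsilon)\le 4\,\rho_v\,\rho_e\,\log\frac{1}{2\epsilon\sqrt{\pi_*}}\,.$$ If $\mathcal M$ is reversible then $\rho_e$ and $\rho_v$ can be taken as sums over unordered pairs $(x,y)$ with undirected edges, and moreover $$\lambda\ge 1-\mathcal C_{\sqrt{a(1-a)}}\ge 2\,\frac{\rho_v}{\rho_e}\left(1-\sqrt{1-1/4\rho_v^2}\right)\ge\frac{1}{4\,\rho_v\,\rho_e},$$ where $\lambda=1-\lambda_2$ is the spectral gap between $1$ and the second largest eigenvalue $\lambda_2$ of the transition matrix $P$.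
   Context: Lazy means $P(x,x)\ge1/2$ for all $x$. $E=\{(x,y):P(x,y)>0\}$ (directed edges); a path $\gamma_{xy}$ is a sequence of consecutive edges of $E$ from $x$ to $y$. The sums are over pairs $x\neq y$ whose path uses the edge $e$, respectively passes through the vertex $v$ (endpoints included). $Q(e)=\pi(u)P(u,v)$ for $e=(u,v)$; $Q(A,y)=\sum_{x\in A}\pi(x)P(x,y)$; $A_u=\{y\in V:Q(A,y)\ge u\,\pi(y)\}$, $u\in[0,1]$. With $f(a)=\sqrt{a(1-a)}$, $\mathcal C_{\sqrt{a(1-a)}}=\max_{A\neq\emptyset,V}\frac{\int_0^1 f(\pi(A_u))\,du}{f(\pi(A))}$. $\pi_*=\min_v\pi(v)$. $\tau(\epsilon)$ is the total variation mixing time: the least $n$ with $\max_{x}\frac12\sum_y|P^n(x,y)-\pi(y)|\le\epsilon$.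
   Formalization: V has at least two states; the bound on τ(ε) is stated for 0<ε≤1/(2√π_* ), beyond which its right side is negative; with unordered pairs its right side is rounded up to an integer, since unrounded it fails for two states with P=1/2, ε=0.45. *)

theory Defs
  imports "HOL-Analysis.Analysis" "HOL-Computational_Algebra.Computational_Algebra"
begin

section \<open>Finite Markov chains\<close>

text \<open>The state space is the universe of a finite type, and \<open>P x y\<close> is the probability
  of moving from \<open>x\<close> to \<open>y\<close>.\<close>

definition stochastic :: "('v::finite \<Rightarrow> 'v \<Rightarrow> real) \<Rightarrow> bool" where
  "stochastic P \<longleftrightarrow> (\<forall>x y. 0 \<le> P x y) \<and> (\<forall>x. (\<Sum>y\<in>UNIV. P x y) = 1)"

primrec kernel_power :: "('v::finite \<Rightarrow> 'v \<Rightarrow> real) \<Rightarrow> nat \<Rightarrow> 'v \<Rightarrow> 'v \<Rightarrow> real" where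
  "kernel_power P 0 = (\<lambda>x y. if x = y then 1 else 0)"
| "kernel_power P (Suc n) = (\<lambda>x y. \<Sum>z\<in>UNIV. P x z * kernel_power P n z y)"

definition irreducible_kernel :: "('v::finite \<Rightarrow> 'v \<Rightarrow> real) \<Rightarrow> bool" where
  "irreducible_kernel P \<longleftrightarrow> (\<forall>x y. \<exists>n. 0 < kernel_power P n x y)"

definition aperiodic_kernel :: "('v::finite \<Rightarrow> 'v \<Rightarrow> real) \<Rightarrow> bool" where
  "aperiodic_kernel P \<longleftrightarrow> (\<forall>x. Gcd {n::nat. 0 < n \<and> 0 < kernel_power P n x x} = 1)"

definition ergodic_chain :: "('v::finite \<Rightarrow> 'v \<Rightarrow> real) \<Rightarrow> bool" where
  "ergodic_chain P \<longleftrightarrow> stochastic P \<and> irreducible_kernel P \<and> aperiodic_kernel P"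

definition lazy_chain :: "('v::finite \<Rightarrow> 'v \<Rightarrow> real) \<Rightarrow> bool" where
  "lazy_chain P \<longleftrightarrow> (\<forall>x. 1 / 2 \<le> P x x)"

definition stationary :: "('v::finite \<Rightarrow> 'v \<Rightarrow> real) \<Rightarrow> ('v \<Rightarrow> real) \<Rightarrow> bool" where
  "stationary P \<pi> \<longleftrightarrow> (\<forall>x. 0 \<le> \<pi> x) \<and> (\<Sum>x\<in>UNIV. \<pi> x) = 1 \<and>
     (\<forall>y. (\<Sum>x\<in>UNIV. \<pi> x * P x y) = \<pi> y)"

definition reversible :: "('v::finite \<Rightarrow> 'v \<Rightarrow> real) \<Rightarrow> ('v \<Rightarrow> real) \<Rightarrow> bool" where
  "reversible P \<pi> \<longleftrightarrow> (\<forall>x y. \<pi> x * P x y = \<pi> y * P y x)"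

definition pi_min :: "('v::finite \<Rightarrow> real) \<Rightarrow> real" where
  "pi_min \<pi> = Min (range \<pi>)"

definition tv_distance :: "('v::finite \<Rightarrow> real) \<Rightarrow> ('v \<Rightarrow> real) \<Rightarrow> real" where
  "tv_distance \<mu> \<nu> = (1 / 2) * (\<Sum>y\<in>UNIV. \<bar>\<mu> y - \<nu> y\<bar>)"

definition mixing_time :: "('v::finite \<Rightarrow> 'v \<Rightarrow> real) \<Rightarrow> ('v \<Rightarrow> real) \<Rightarrow> real \<Rightarrow> nat" where
  "mixing_time P \<pi> \<epsilon> =
     (LEAST n. Max (range (\<lambda>x. tv_distance (kernel_power P n x) \<pi>)) \<le> \<epsilon>)"

section \<open>Evolving sets\<close>

definition ergodic_flow ::
  "('v::finite \<Rightarrow> 'v \<Rightarrow> real) \<Rightarrow> ('v \<Rightarrow> real) \<Rightarrow> 'v set \<Rightarrow> 'v \<Rightarrow> real" where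
  "ergodic_flow P \<pi> A y = (\<Sum>x\<in>A. \<pi> x * P x y)"

definition evolved_set ::
  "('v::finite \<Rightarrow> 'v \<Rightarrow> real) \<Rightarrow> ('v \<Rightarrow> real) \<Rightarrow> 'v set \<Rightarrow> real \<Rightarrow> 'v set" where
  "evolved_set P \<pi> A u = {y. ergodic_flow P \<pi> A y \<ge> u * \<pi> y}"

definition evolving_set_constant ::
  "(real \<Rightarrow> real) \<Rightarrow> ('v::finite \<Rightarrow> 'v \<Rightarrow> real) \<Rightarrow> ('v \<Rightarrow> real) \<Rightarrow> real" where
  "evolving_set_constant f P \<pi> =
     Max ((\<lambda>A. integral {0..1} (\<lambda>u. f (sum \<pi> (evolved_set P \<pi> A u))) / f (sum \<pi> A))
          ` {A. A \<noteq> {} \<and> A \<noteq> UNIV})"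

definition C_sqrt :: "('v::finite \<Rightarrow> 'v \<Rightarrow> real) \<Rightarrow> ('v \<Rightarrow> real) \<Rightarrow> real" where
  "C_sqrt = evolving_set_constant (\<lambda>a. sqrt (a * (1 - a)))"

section \<open>Paths and their edge and vertex loads\<close>

text \<open>Self-loops count as edges, and paths may repeat edges and vertices; a pair is counted
  once for an edge or vertex, however often its path visits it.\<close>

definition edges :: "('v::finite \<Rightarrow> 'v \<Rightarrow> real) \<Rightarrow> ('v \<times> 'v) set" where
  "edges P = {(x, y). 0 < P x y}"

primrec is_path ::
  "('v::finite \<Rightarrow> 'v \<Rightarrow> real) \<Rightarrow> 'v \<Rightarrow> ('v \<times> 'v) list \<Rightarrow> 'v \<Rightarrow> bool" where
  "is_path P x [] y \<longleftrightarrow> x = y"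
| "is_path P x (e # es) y \<longleftrightarrow> e \<in> edges P \<and> fst e = x \<and> is_path P (snd e) es y"

definition path_vertices :: "('v \<times> 'v) list \<Rightarrow> 'v set" where
  "path_vertices p = fst ` set p \<union> snd ` set p"

definition edge_weight ::
  "('v::finite \<Rightarrow> 'v \<Rightarrow> real) \<Rightarrow> ('v \<Rightarrow> real) \<Rightarrow> 'v \<times> 'v \<Rightarrow> real" where
  "edge_weight P \<pi> e = \<pi> (fst e) * P (fst e) (snd e)"

definition path_system ::
  "('v::finite \<Rightarrow> 'v \<Rightarrow> real) \<Rightarrow> ('v \<Rightarrow> 'v \<Rightarrow> ('v \<times> 'v) list) \<Rightarrow> bool" where
  "path_system P \<Gamma> \<longleftrightarrow> (\<forall>x y. x \<noteq> y \<longrightarrow> is_path P x (\<Gamma> x y) y)"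

definition rho_e ::
  "('v::finite \<Rightarrow> 'v \<Rightarrow> real) \<Rightarrow> ('v \<Rightarrow> real) \<Rightarrow> ('v \<Rightarrow> 'v \<Rightarrow> ('v \<times> 'v) list) \<Rightarrow> real" where
  "rho_e P \<pi> \<Gamma> =
     Max ((\<lambda>e. 1 / edge_weight P \<pi> e *
               (\<Sum>(x, y)\<in>{(x, y). x \<noteq> y \<and> e \<in> set (\<Gamma> x y)}. \<pi> x * \<pi> y)) ` edges P)"

definition rho_v :: "('v::finite \<Rightarrow> real) \<Rightarrow> ('v \<Rightarrow> 'v \<Rightarrow> ('v \<times> 'v) list) \<Rightarrow> real" where
  "rho_v \<pi> \<Gamma> =
     Max (range (\<lambda>v. 1 / \<pi> v *
               (\<Sum>(x, y)\<in>{(x, y). x \<noteq> y \<and> v \<in> path_vertices (\<Gamma> x y)}. \<pi> x * \<pi> y)))"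

subsection \<open>Unordered pairs and undirected edges\<close>

text \<open>For reversible chains one path is chosen per two-element set \<open>{x, y}\<close>. It is stored as a
  directed path in either orientation, which is immaterial: the reverse of a path is again a
  path, and the loads below do not depend on the orientation. For \<open>s = {x, y}\<close> the product
  \<open>prod \<pi> s\<close> is \<open>\<pi> x * \<pi> y\<close>. An undirected edge \<open>{u, v}\<close> is represented by \<open>(u, v)\<close> or \<open>(v, u)\<close>,
  which have the same weight by reversibility.\<close>

definition unordered_pairs :: "'v set set" where
  "unordered_pairs = {{x, y} | x y. x \<noteq> y}"

definition undirected_path_system ::
  "('v::finite \<Rightarrow> 'v \<Rightarrow> real) \<Rightarrow> ('v set \<Rightarrow> ('v \<times> 'v) list) \<Rightarrow> bool" where
  "undirected_path_system P \<Delta> \<longleftrightarrow>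
     (\<forall>x y. x \<noteq> y \<longrightarrow> is_path P x (\<Delta> {x, y}) y \<or> is_path P y (\<Delta> {x, y}) x)"

definition undirected_rho_e ::
  "('v::finite \<Rightarrow> 'v \<Rightarrow> real) \<Rightarrow> ('v \<Rightarrow> real) \<Rightarrow> ('v set \<Rightarrow> ('v \<times> 'v) list) \<Rightarrow> real" where
  "undirected_rho_e P \<pi> \<Delta> =
     Max ((\<lambda>(u, v). 1 / edge_weight P \<pi> (u, v) *
               (\<Sum>s\<in>{s \<in> unordered_pairs. (u, v) \<in> set (\<Delta> s) \<or> (v, u) \<in> set (\<Delta> s)}. prod \<pi> s))
          ` edges P)"

definition undirected_rho_v ::
  "('v::finite \<Rightarrow> real) \<Rightarrow> ('v set \<Rightarrow> ('v \<times> 'v) list) \<Rightarrow> real" where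
  "undirected_rho_v \<pi> \<Delta> =
     Max (range (\<lambda>v. 1 / \<pi> v *
               (\<Sum>s\<in>{s \<in> unordered_pairs. v \<in> path_vertices (\<Delta> s)}. prod \<pi> s)))"

section \<open>Spectral gap\<close>

definition kernel_charpoly :: "('v::finite \<Rightarrow> 'v \<Rightarrow> real) \<Rightarrow> real poly" where
  "kernel_charpoly P =
     det (\<chi> i j. (if i = j then [:0, 1:] else 0) - [:P i j:] :: real poly ^ 'v ^ 'v)"

text \<open>The real eigenvalues in decreasing order, repeated according to algebraic multiplicity.
  For a reversible kernel with positive stationary distribution the list has length
  \<open>CARD('v)\<close>, all eigenvalues being real.\<close>

definition kernel_eigenvalues :: "('v::finite \<Rightarrow> 'v \<Rightarrow> real) \<Rightarrow> real list" where
  "kernel_eigenvalues P = rev (sorted_list_of_multiset (proots (kernel_charpoly P)))"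

definition spectral_gap :: "('v::finite \<Rightarrow> 'v \<Rightarrow> real) \<Rightarrow> real" where
  "spectral_gap P = 1 - kernel_eigenvalues P ! 1"

end

theory Submission
  imports Defs
begin

text \<open>
  Write \<open>f(a) = sqrt (a (1 - a))\<close> and let \<open>w\<^sub>A\<close> be the restriction of \<open>\<pi>\<close> to \<open>A\<close>.
  Since \<open>w\<^sub>A P\<close> is the average over \<open>u \<in> [0,1]\<close> of the measures of the evolved sets \<open>A\<^sub>u\<close>,
  the chi-square distance of \<open>w\<^sub>A P^n\<close> to its stationary multiple is at most \<open>C^n f(\<pi> A)\<close>;
  this gives both the mixing time bound and \<open>|\<mu>| \<le> C\<close> for every eigenvalue
  whose eigenfunction has mean zero.

  To bound \<open>C\<close>, cut \<open>[0,1]\<close> at \<open>t\<close> and \<open>1 - t\<close>, where \<open>t = min (1/2) (\<rho>v/\<rho>e)\<close>, and on each of the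
  three pieces replace \<open>f\<close> by a tangent line. Each path from \<open>A\<close> to its complement enters the
  complement at some vertex \<open>y\<close>. The flow \<open>F y\<close> entering at \<open>y\<close> is at most \<open>\<rho>v \<pi> y\<close> and at most
  \<open>\<rho>e Q(A,y)\<close>, and its total is \<open>\<pi>(A) (1 - \<pi>(A))\<close>, so that the integral of \<open>\<pi>(A\<^sub>u)\<close> over \<open>[0,t]\<close>
  exceeds \<open>t \<pi>(A)\<close> by at least \<open>\<pi>(A) (1 - \<pi>(A)) / \<rho>e\<close>; the complement of \<open>A\<close> gives the same
  on \<open>[1-t,1]\<close>. The best slopes then yield the stated bound.
\<close>

section \<open>Contraction by evolving sets\<close>

locale positive_chain =
  fixes P :: "'v::finite \<Rightarrow> 'v \<Rightarrow> real" and \<pi> :: "'v \<Rightarrow> real"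
  assumes stochastic: "stochastic P"
    and stationary: "stationary P \<pi>"
    and pi_pos [simp]: "0 < \<pi> x"
begin

section \<open>Elementary bounds for \<open>\<pi>\<close> and for the ergodic flow\<close>

lemma P_nonneg [simp]: "0 \<le> P x y"
  and P_sum [simp]: "(\<Sum>y\<in>UNIV. P x y) = 1"
  using stochastic by (auto simp: stochastic_def)

lemma pi_nonneg [simp]: "0 \<le> \<pi> x"
  using pi_pos[of x] by linarith

lemma pi_nonzero [simp]: "\<pi> x \<noteq> 0"
  using pi_pos[of x] by linarith

lemma pi_sum [simp]: "sum \<pi> UNIV = 1"
  and pi_P: "(\<Sum>x\<in>UNIV. \<pi> x * P x y) = \<pi> y"
  using stationary by (auto simp: stationary_def)

lemma pi_Compl: "sum \<pi> (- A) = 1 - sum \<pi> A"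
  using sum.subset_diff[of A UNIV \<pi>] by (simp add: Compl_eq_Diff_UNIV)

lemma pi_set_nonneg [simp]: "0 \<le> sum \<pi> A"
  by (simp add: sum_nonneg)

lemma pi_set_le_1 [simp]: "sum \<pi> A \<le> 1"
  using pi_Compl[of A] pi_set_nonneg[of "- A"] by linarith

lemma pi_set_pos: "A \<noteq> {} \<Longrightarrow> 0 < sum \<pi> A"
  by (simp add: sum_pos)

lemma pi_set_less_1: "A \<noteq> UNIV \<Longrightarrow> sum \<pi> A < 1"
  using pi_Compl[of A] pi_set_pos[of "- A"] by fastforce

lemma flow_nonneg [simp]: "0 \<le> ergodic_flow P \<pi> A y"
  by (simp add: ergodic_flow_def sum_nonneg)

lemma flow_Compl: "ergodic_flow P \<pi> (- A) y = \<pi> y - ergodic_flow P \<pi> A y"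
  using sum.subset_diff[of A UNIV "\<lambda>x. \<pi> x * P x y"] pi_P[of y]
  by (simp add: ergodic_flow_def Compl_eq_Diff_UNIV)

lemma flow_le [simp]: "ergodic_flow P \<pi> A y \<le> \<pi> y"
  using flow_Compl[of A y] flow_nonneg[of "- A" y] by linarith

lemma sum_flow: "(\<Sum>y\<in>UNIV. ergodic_flow P \<pi> A y) = sum \<pi> A"
  unfolding ergodic_flow_def by (subst sum.swap) (simp flip: sum_distrib_left)

lemma mem_evolved_set:
  "y \<in> evolved_set P \<pi> A u \<longleftrightarrow> u \<le> ergodic_flow P \<pi> A y / \<pi> y"
  by (simp add: evolved_set_def field_simps)

lemma evolved_set_antimono: "u \<le> u' \<Longrightarrow> evolved_set P \<pi> A u' \<subseteq> evolved_set P \<pi> A u"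
  by (auto simp: mem_evolved_set)

text \<open>For \<open>u\<close> uniform in \<open>[0,1]\<close> this is the probability that the
  evolved set of \<open>A\<close> is \<open>B\<close>, that is, the transition kernel of the
  evolving set process.\<close>

definition level :: "'v set \<Rightarrow> 'v set \<Rightarrow> real" where
  "level A B = measure lebesgue {u \<in> {0..1}. evolved_set P \<pi> A u = B}"

lemma level_nonneg [simp]: "0 \<le> level A B"
  by (simp add: level_def)

text \<open>Evolved sets shrink as \<open>u\<close> grows, so the parameters that give
  \<open>B\<close> form an interval, which is measurable.\<close>

lemma level_has_integral:
  "((\<lambda>u. if evolved_set P \<pi> A u = B then 1 else 0) has_integral level A B) {0..1}"
proof -
  let ?S = "{u \<in> {0..1}. evolved_set P \<pi> A u = B}"
  have "is_interval ?S"
    unfolding is_interval_1 using evolved_set_antimono[of _ _ A] by fastforce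
  then have "convex ?S"
    by (simp add: is_interval_convex)
  moreover have "bounded ?S"
    by (rule bounded_subset[of "{0..1}"]) auto
  ultimately have "?S \<in> lmeasurable"
    by (rule measurable_convex)
  then have "(indicat_real ?S has_integral level A B) UNIV"
    by (simp add: lmeasurable_iff_has_integral level_def)
  moreover have "indicat_real ?S =
      (\<lambda>u. if u \<in> {0..1} then if evolved_set P \<pi> A u = B then 1 else 0 else 0)"
    by (auto simp: indicator_def)
  ultimately show ?thesis
    by (simp only: has_integral_restrict_UNIV)
qed

text \<open>There are only finitely many sets \<open>B\<close>, so a function of the evolved set is
  a step function of \<open>u\<close> and its integral is a finite sum.\<close>

lemma evolved_set_has_integral:
  "((\<lambda>u. g (evolved_set P \<pi> A u)) has_integral (\<Sum>B\<in>UNIV. g B * level A B)) {0..1}"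
  for g :: "'v set \<Rightarrow> real"
proof -
  have "((\<lambda>u. \<Sum>B\<in>UNIV. g B * (if evolved_set P \<pi> A u = B then 1 else 0)) has_integral
      (\<Sum>B\<in>UNIV. g B * level A B)) {0..1}"
    by (intro has_integral_sum has_integral_mult_right level_has_integral) auto
  moreover have "(\<Sum>B\<in>UNIV. g B * (if evolved_set P \<pi> A u = B then 1 else 0)) =
      g (evolved_set P \<pi> A u)" for u
    by (simp add: if_distrib[of "(*) _"] cong: if_cong)
  ultimately show ?thesis
    by simp
qed

end

lemma has_integral_threshold:
  fixes c t :: real
  assumes "0 \<le> c" "0 \<le> t"
  shows "((\<lambda>u. if u \<le> c then 1 else 0) has_integral min t c) {0..t}"
proof -
  have "((\<lambda>u::real. 1::real) has_integral min t c) {0..min t c}"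
    using has_integral_const_real[of "1::real" 0 "min t c"] assms by simp
  then have "((\<lambda>u. if u \<in> {0..min t c} then 1 else 0::real) has_integral min t c) {0..t}"
    by (subst has_integral_restrict) auto
  then show ?thesis
    by (rule has_integral_eq[rotated]) auto
qed

context positive_chain
begin

text \<open>The state \<open>y\<close> lies in the evolved set exactly for \<open>u\<close> up to
  \<open>ergodic_flow P \<pi> A y / \<pi> y\<close>. Hence one step of the chain from the
  restriction of \<open>\<pi>\<close> to \<open>A\<close> is the \<open>level\<close>-mixture of the
  restrictions to the sets \<open>B\<close>.\<close>

lemma sum_level_flow:
  "(\<Sum>B\<in>UNIV. level A B * (if y \<in> B then \<pi> y else 0)) = ergodic_flow P \<pi> A y"
proof -
  have "((\<lambda>u. if y \<in> evolved_set P \<pi> A u then 1 else 0) has_integral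
      min 1 (ergodic_flow P \<pi> A y / \<pi> y)) {0..1}"
    unfolding mem_evolved_set by (rule has_integral_threshold) auto
  then have "(\<Sum>B\<in>UNIV. (if y \<in> B then 1 else 0) * level A B) = min 1 (ergodic_flow P \<pi> A y / \<pi> y)"
    using evolved_set_has_integral[of "\<lambda>B. if y \<in> B then 1 else 0" A] has_integral_unique by blast
  also have "\<dots> = ergodic_flow P \<pi> A y / \<pi> y"
    by (simp add: min_def field_simps order.antisym)
  finally have *: "(\<Sum>B\<in>UNIV. (if y \<in> B then 1 else 0) * level A B) = ergodic_flow P \<pi> A y / \<pi> y" .
  have "(\<Sum>B\<in>UNIV. level A B * (if y \<in> B then \<pi> y else 0)) =
      \<pi> y * (\<Sum>B\<in>UNIV. (if y \<in> B then 1 else 0) * level A B)"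
    unfolding sum_distrib_left by (intro sum.cong) auto
  then show ?thesis
    unfolding * by simp
qed

abbreviation spread :: "'v set \<Rightarrow> real" where
  "spread A \<equiv> sqrt (sum \<pi> A * (1 - sum \<pi> A))"

lemma spread_pos: "A \<noteq> {} \<Longrightarrow> A \<noteq> UNIV \<Longrightarrow> 0 < spread A"
  using pi_set_pos pi_set_less_1 by simp

lemma C_sqrt_ge:
  assumes "A \<noteq> {}" "A \<noteq> UNIV"
  shows "integral {0..1} (\<lambda>u. spread (evolved_set P \<pi> A u)) / spread A \<le> C_sqrt P \<pi>"
  unfolding C_sqrt_def evolving_set_constant_def
  by (rule Max_ge) (use assms in auto)

text \<open>Evolved sets can be empty or full even when \<open>A\<close> is neither, so iteration
  needs the contraction also for the two sets left out of the maximum; there both sides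
  vanish.\<close>

lemma sum_level_spread: "(\<Sum>B\<in>UNIV. spread B * level A B) \<le> C_sqrt P \<pi> * spread A"
proof -
  have eq: "integral {0..1} (\<lambda>u. spread (evolved_set P \<pi> A u)) = (\<Sum>B\<in>UNIV. spread B * level A B)"
    using evolved_set_has_integral by (rule integral_unique)
  show ?thesis
  proof (cases "A = {} \<or> A = UNIV")
    case True
    have "spread (evolved_set P \<pi> A u) = 0" if "u \<in> {0..1}" for u
    proof (cases "A = {}")
      case True
      \<comment> \<open>The empty set sends out no flow: \<open>u = 0\<close> gives the whole space
        and \<open>u > 0\<close> the empty set, both of spread 0.\<close>
      then have "evolved_set P \<pi> A u = {} \<or> evolved_set P \<pi> A u = UNIV"
        by (auto simp: mem_evolved_set ergodic_flow_def)
      then show ?thesis by auto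
    next
      case False
      with True have "A = UNIV" by simp
      then have "evolved_set P \<pi> A u = UNIV"
        using that by (auto simp: mem_evolved_set ergodic_flow_def pi_P)
      then show ?thesis by simp
    qed
    then have "integral {0..1} (\<lambda>u. spread (evolved_set P \<pi> A u)) = integral {0..1} (\<lambda>u::real. 0)"
      by (intro integral_cong) auto
    with eq True show ?thesis by auto
  next
    case False
    then have "integral {0..1} (\<lambda>u. spread (evolved_set P \<pi> A u)) / spread A \<le> C_sqrt P \<pi>"
      by (intro C_sqrt_ge) auto
    then show ?thesis
      using spread_pos[of A] False unfolding eq by (simp add: pos_divide_le_eq)
  qed
qed

text \<open>With two states a singleton is a proper subset of positive spread, and the contraction
  inequality for it forces the sign.\<close>

lemma C_sqrt_nonneg:
  assumes "2 \<le> CARD('v)"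
  shows "0 \<le> C_sqrt P \<pi>"
proof -
  define x :: 'v where "x = undefined"
  have "{x} \<noteq> UNIV"
  proof
    assume "{x} = UNIV"
    then have "CARD('v) = card {x}" by simp
    with assms show False by simp
  qed
  then have s: "0 < spread {x}"
    by (intro spread_pos) auto
  have "0 \<le> (\<Sum>B\<in>UNIV. spread B * level {x} B)"
    by (intro sum_nonneg mult_nonneg_nonneg) auto
  then have "0 \<le> C_sqrt P \<pi> * spread {x}"
    using sum_level_spread[of "{x}"] by linarith
  with s show ?thesis
    by (simp add: zero_le_mult_iff)
qed

text \<open>For a probability vector this is the square root of its chi-square distance to
  \<open>\<pi>\<close>. Subtracting the total mass times \<open>\<pi>\<close> gives a seminorm on
  vectors of any mass, which is convex under mixtures.\<close>

definition imbalance :: "('v \<Rightarrow> real) \<Rightarrow> real" where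
  "imbalance w = L2_set (\<lambda>y. (w y - sum w UNIV * \<pi> y) / sqrt (\<pi> y)) UNIV"

lemma imbalance_add: "imbalance (\<lambda>y. v y + w y) \<le> imbalance v + imbalance w"
proof -
  have "imbalance (\<lambda>y. v y + w y) =
      L2_set (\<lambda>y. (v y - sum v UNIV * \<pi> y) / sqrt (\<pi> y) + (w y - sum w UNIV * \<pi> y) / sqrt (\<pi> y)) UNIV"
    unfolding imbalance_def
    by (intro arg_cong2[where f = L2_set] ext) (simp_all add: sum.distrib field_simps)
  also have "\<dots> \<le> imbalance v + imbalance w"
    unfolding imbalance_def by (rule L2_set_triangle_ineq)
  finally show ?thesis .
qed

lemma imbalance_scale: "0 \<le> c \<Longrightarrow> imbalance (\<lambda>y. c * w y) = c * imbalance w"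
  unfolding imbalance_def
  by (subst L2_set_right_distrib)
    (auto simp: sum_distrib_left[symmetric] algebra_simps diff_divide_distrib
      intro!: arg_cong2[where f = L2_set])

lemma imbalance_sum:
  assumes "finite S" "\<And>B. B \<in> S \<Longrightarrow> 0 \<le> c B"
  shows "imbalance (\<lambda>y. \<Sum>B\<in>S. c B * w B y) \<le> (\<Sum>B\<in>S. c B * imbalance (w B))"
  using assms
proof (induction S rule: finite_induct)
  case empty
  then show ?case by (simp add: imbalance_def L2_set_def)
next
  case (insert B S)
  have "imbalance (\<lambda>y. \<Sum>B\<in>insert B S. c B * w B y) \<le>
      imbalance (\<lambda>y. c B * w B y) + imbalance (\<lambda>y. \<Sum>B\<in>S. c B * w B y)"
    using insert imbalance_add by simp
  also have "\<dots> \<le> c B * imbalance (w B) + (\<Sum>B\<in>S. c B * imbalance (w B))"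
    using insert by (simp add: imbalance_scale)
  finally show ?case
    using insert by simp
qed

text \<open>This is where \<open>sqrt (a * (1 - a))\<close> comes from: the squared imbalance is the
  variance under \<open>\<pi>\<close> of the indicator of \<open>A\<close>.\<close>

lemma imbalance_set: "imbalance (\<lambda>y. if y \<in> A then \<pi> y else 0) = spread A"
proof -
  let ?a = "sum \<pi> A"
  have s: "(\<Sum>y\<in>UNIV. if y \<in> A then \<pi> y else 0) = ?a"
    by (simp add: sum.If_cases)
  have "(((if y \<in> A then \<pi> y else 0) - ?a * \<pi> y) / sqrt (\<pi> y))\<^sup>2 =
      (if y \<in> A then (1 - 2 * ?a) * \<pi> y else 0) + ?a\<^sup>2 * \<pi> y" for y
  proof -
    have "(((if y \<in> A then \<pi> y else 0) - ?a * \<pi> y) / sqrt (\<pi> y))\<^sup>2 =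
        ((if y \<in> A then \<pi> y else 0) - ?a * \<pi> y)\<^sup>2 / \<pi> y"
      by (simp add: power_divide)
    also have "\<dots> = (if y \<in> A then (1 - 2 * ?a) * \<pi> y else 0) + ?a\<^sup>2 * \<pi> y"
      by (simp add: field_simps power2_eq_square)
    finally show ?thesis .
  qed
  then have "(\<Sum>y\<in>UNIV. (((if y \<in> A then \<pi> y else 0) - ?a * \<pi> y) / sqrt (\<pi> y))\<^sup>2) =
      (\<Sum>y\<in>UNIV. (if y \<in> A then (1 - 2 * ?a) * \<pi> y else 0) + ?a\<^sup>2 * \<pi> y)"
    by simp
  also have "\<dots> = (1 - 2 * ?a) * ?a + ?a\<^sup>2"
    by (simp add: sum.distrib sum.If_cases flip: sum_distrib_left)
  also have "\<dots> = ?a * (1 - ?a)"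
    by (simp add: power2_eq_square algebra_simps)
  finally show ?thesis
    unfolding imbalance_def L2_set_def s by simp
qed

section \<open>Decay of the imbalance under powers of the kernel\<close>

lemma kernel_power_sum [simp]: "(\<Sum>y\<in>UNIV. kernel_power P n x y) = 1"
proof (induction n arbitrary: x)
  case (Suc n)
  have "(\<Sum>y\<in>UNIV. kernel_power P (Suc n) x y) =
      (\<Sum>z\<in>UNIV. P x z * (\<Sum>y\<in>UNIV. kernel_power P n z y))"
    by (simp add: sum_distrib_left) (rule sum.swap)
  with Suc show ?case by simp
qed simp

text \<open>Induction with \<open>A\<close> free: the first step replaces \<open>A\<close> by a
  mixture of sets \<open>B\<close>, the triangle inequality separates them, the hypothesis covers
  the remaining \<open>n\<close> steps from each \<open>B\<close>, and
  \<open>sum_level_spread\<close> supplies one more factor \<open>C_sqrt P \<pi>\<close>.\<close>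

lemma imbalance_kernel_power:
  assumes "2 \<le> CARD('v)"
  shows "imbalance (\<lambda>y. \<Sum>x\<in>A. \<pi> x * kernel_power P n x y) \<le> C_sqrt P \<pi> ^ n * spread A"
proof (induction n arbitrary: A)
  case 0
  have "(\<lambda>y. \<Sum>x\<in>A. \<pi> x * kernel_power P 0 x y) = (\<lambda>y. if y \<in> A then \<pi> y else 0)"
    by (auto simp: if_distrib cong: if_cong)
  then show ?case
    by (simp add: imbalance_set)
next
  case (Suc n)
  have "(\<Sum>x\<in>A. \<pi> x * kernel_power P (Suc n) x y) =
      (\<Sum>B\<in>UNIV. level A B * (\<Sum>x\<in>B. \<pi> x * kernel_power P n x y))" for y
  proof -
    have "(\<Sum>x\<in>A. \<pi> x * kernel_power P (Suc n) x y) =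
        (\<Sum>z\<in>UNIV. ergodic_flow P \<pi> A z * kernel_power P n z y)"
      by (simp add: ergodic_flow_def sum_distrib_left sum_distrib_right mult.assoc) (rule sum.swap)
    also have "\<dots> = (\<Sum>B\<in>UNIV. \<Sum>z\<in>UNIV. level A B * (if z \<in> B then \<pi> z else 0) * kernel_power P n z y)"
      unfolding sum_level_flow[symmetric] sum_distrib_right by (rule sum.swap)
    also have "\<dots> = (\<Sum>B\<in>UNIV. level A B * (\<Sum>z\<in>UNIV. if z \<in> B then \<pi> z * kernel_power P n z y else 0))"
      unfolding sum_distrib_left by (intro sum.cong) auto
    finally show ?thesis
      by (simp add: sum.If_cases)
  qed
  then have "imbalance (\<lambda>y. \<Sum>x\<in>A. \<pi> x * kernel_power P (Suc n) x y) \<le>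
      (\<Sum>B\<in>UNIV. level A B * imbalance (\<lambda>y. \<Sum>x\<in>B. \<pi> x * kernel_power P n x y))"
    by (simp add: imbalance_sum del: kernel_power.simps)
  also have "\<dots> \<le> (\<Sum>B\<in>UNIV. level A B * (C_sqrt P \<pi> ^ n * spread B))"
    using Suc by (intro sum_mono mult_left_mono) auto
  also have "\<dots> = C_sqrt P \<pi> ^ n * (\<Sum>B\<in>UNIV. spread B * level A B)"
    by (simp add: sum_distrib_left mult_ac)
  also have "\<dots> \<le> C_sqrt P \<pi> ^ n * (C_sqrt P \<pi> * spread A)"
    using C_sqrt_nonneg[OF assms] by (intro mult_left_mono sum_level_spread) auto
  finally show ?case
    by (simp add: mult_ac)
qed

text \<open>Take \<open>A = {x}\<close> and divide by \<open>\<pi> x\<close>; Cauchy-Schwarz with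
  the weights \<open>\<pi>\<close> of total mass 1 turns the chi-square bound into an L1
  bound.\<close>

lemma kernel_power_contraction:
  assumes "2 \<le> CARD('v)"
  shows "(\<Sum>y\<in>UNIV. \<bar>kernel_power P n x y - \<pi> y\<bar>) \<le> C_sqrt P \<pi> ^ n * sqrt ((1 - \<pi> x) / \<pi> x)"
proof -
  let ?D = "\<lambda>y. kernel_power P n x y - \<pi> y"
  have s: "(\<Sum>y\<in>UNIV. \<pi> x * kernel_power P n x y) = \<pi> x"
    by (simp flip: sum_distrib_left)
  have "imbalance (\<lambda>y. \<pi> x * kernel_power P n x y) = \<pi> x * L2_set (\<lambda>y. ?D y / sqrt (\<pi> y)) UNIV"
    unfolding imbalance_def s
    by (subst L2_set_right_distrib) (auto simp: algebra_simps intro!: arg_cong2[where f = L2_set])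
  moreover have "imbalance (\<lambda>y. \<pi> x * kernel_power P n x y) \<le> C_sqrt P \<pi> ^ n * spread {x}"
    using imbalance_kernel_power[OF assms, of n "{x}"] by simp
  moreover have "spread {x} = \<pi> x * sqrt ((1 - \<pi> x) / \<pi> x)"
    using real_sqrt_mult[of "(\<pi> x)\<^sup>2" "(1 - \<pi> x) / \<pi> x"] by (simp add: power2_eq_square)
  ultimately have "\<pi> x * L2_set (\<lambda>y. ?D y / sqrt (\<pi> y)) UNIV \<le>
      \<pi> x * (C_sqrt P \<pi> ^ n * sqrt ((1 - \<pi> x) / \<pi> x))"
    by (simp add: mult_ac)
  then have *: "L2_set (\<lambda>y. ?D y / sqrt (\<pi> y)) UNIV \<le> C_sqrt P \<pi> ^ n * sqrt ((1 - \<pi> x) / \<pi> x)"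
    by (simp only: mult_le_cancel_left_pos pi_pos)
  have "(\<Sum>y\<in>UNIV. \<bar>?D y\<bar>) = (\<Sum>y\<in>UNIV. \<bar>?D y / sqrt (\<pi> y)\<bar> * \<bar>sqrt (\<pi> y)\<bar>)"
    by (simp add: abs_mult[symmetric] abs_divide)
  also have "\<dots> \<le> L2_set (\<lambda>y. ?D y / sqrt (\<pi> y)) UNIV * L2_set (\<lambda>y. sqrt (\<pi> y)) UNIV"
    by (rule L2_set_mult_ineq)
  also have "L2_set (\<lambda>y. sqrt (\<pi> y)) UNIV = 1"
    by (simp add: L2_set_def)
  finally show ?thesis
    using * by simp
qed

end

section \<open>The evolving set constant of a chain with a flow bound\<close>

text \<open>Arithmetic-geometric mean. As a function of \<open>x\<close> the right side is the
  tangent line of the concave left side at \<open>x = 1 / (1 + l^2)\<close>.\<close>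

lemma sqrt_mult_le_weighted_mean:
  fixes x l :: real
  assumes "0 \<le> x" "x \<le> 1" "0 < l"
  shows "sqrt (x * (1 - x)) \<le> (l * x + (1 - x) / l) / 2"
  using arith_geo_mean_sqrt[of "l * x" "(1 - x) / l"] assms by simp

text \<open>In use, \<open>p^2\<close> and \<open>m^2\<close> are the measures of \<open>A\<close>
  and its complement, \<open>S\<close> and \<open>J\<close> their values of
  \<open>truncated_flow\<close> at \<open>t\<close>, and \<open>c = 1 / (2 * e)\<close>; the slopes
  on the three pieces are \<open>k * (m / p)\<close>, \<open>m / p\<close> and
  \<open>m / p / k\<close>. For \<open>k \<le> 1\<close> the left side is nonincreasing in
  \<open>S\<close> and \<open>J\<close>, hence largest at their lower bounds, where it equals the
  right side.\<close>

lemma three_slope_bound: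
  fixes p m k t c S J :: real
  assumes "0 < p" "0 < m" "p\<^sup>2 + m\<^sup>2 = 1" "0 < k" "k \<le> 1"
    and S: "t * p\<^sup>2 + 2 * c * p\<^sup>2 * m\<^sup>2 \<le> S"
    and J: "t * m\<^sup>2 + 2 * c * p\<^sup>2 * m\<^sup>2 \<le> J"
  shows "(k * (m / p) * S + (t - S) / (k * (m / p))) / 2 +
      (m / p * (p\<^sup>2 - t + J - S) + (1 - 2 * t - (p\<^sup>2 - t + J - S)) / (m / p)) / 2 +
      (m / p / k * (t - J) + J / (m / p / k)) / 2
    \<le> p * m * (1 - 2 * t + k * (t + c) + (t - c) / k)" (is "?T S J \<le> ?R")
proof -
  let ?S = "t * p\<^sup>2 + 2 * c * p\<^sup>2 * m\<^sup>2" and ?J = "t * m\<^sup>2 + 2 * c * p\<^sup>2 * m\<^sup>2"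
  \<comment> \<open>\<open>?u / 2\<close> and \<open>?v / 2\<close> are the rates at which the left
    side falls in \<open>S\<close> and in \<open>J\<close>.\<close>
  let ?u = "(1 - k) * (m / p) + (1 / k - 1) * (p / m)"
  let ?v = "(1 / k - 1) * (m / p) + (1 - k) * (p / m)"
  \<comment> \<open>The reciprocals get names, \<open>i\<close> for \<open>1 / k\<close>,
    \<open>a\<close> for \<open>m / p\<close> and \<open>b\<close> for \<open>p / m\<close>, which
    leaves a polynomial identity.\<close>
  have linear: "(k * a * S + (t - S) * i * b) / 2 + (a * (q - t + J - S) + (1 - 2 * t - (q - t + J - S)) * b) / 2 +
      (a * i * (t - J) + J * k * b) / 2 =
      (k * a * S' + (t - S') * i * b) / 2 + (a * (q - t + J' - S') + (1 - 2 * t - (q - t + J' - S')) * b) / 2 +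
      (a * i * (t - J') + J' * k * b) / 2 -
      ((S - S') * ((1 - k) * a + (i - 1) * b) + (J - J') * ((i - 1) * a + (1 - k) * b)) / 2"
    for a b i q S J S' J' :: real
    by (simp add: algebra_simps add_divide_distrib diff_divide_distrib)
  have main: "?T S J = ?T ?S ?J - ((S - ?S) * ?u + (J - ?J) * ?v) / 2"
  proof -
    have "x / (k * (m / p)) = x * (1 / k) * (p / m)" "x / (m / p) = x * (p / m)"
      "x / (m / p / k) = x * k * (p / m)" "m / p / k = m / p * (1 / k)" for x
      using assms(1,2,4) by auto
    then show ?thesis
      by (simp only: linear)
  qed
  have uv: "0 \<le> ?u" "0 \<le> ?v"
    using assms(1,2,4,5) by (auto intro!: add_nonneg_nonneg mult_nonneg_nonneg
        simp del: times_divide_eq_right)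
  have nonneg: "0 \<le> (S - ?S) * ?u + (J - ?J) * ?v"
    by (rule add_nonneg_nonneg; rule mult_nonneg_nonneg) (use S J uv in \<open>simp_all only: diff_ge_0_iff_ge\<close>)
  \<comment> \<open>At the lower bounds each of the six terms has the factor \<open>p * m\<close>,
    because \<open>m^2 = 1 - p^2\<close>.\<close>
  have min: "?T ?S ?J = ?R"
  proof -
    have m: "m\<^sup>2 = 1 - p\<^sup>2" using assms(3) by simp
    have "k * (m / p) * ?S = p * m * (k * (t + 2 * c * m\<^sup>2))"
      using assms(1) by (simp add: field_simps power2_eq_square)
    moreover have "(t - ?S) / (k * (m / p)) = p * m * ((t - 2 * c * p\<^sup>2) / k)"
    proof -
      have eq: "t - ?S = m\<^sup>2 * (t - 2 * c * p\<^sup>2)"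
        unfolding m by (simp add: algebra_simps)
      show ?thesis
        unfolding eq using assms(1,2,4) by (simp add: field_simps power2_eq_square)
    qed
    moreover have "m / p / k * (t - ?J) = p * m * ((t - 2 * c * m\<^sup>2) / k)"
    proof -
      have eq: "t - ?J = p\<^sup>2 * (t - 2 * c * m\<^sup>2)"
        unfolding m by (simp add: algebra_simps)
      show ?thesis
        unfolding eq using assms(1,2,4) by (simp add: field_simps power2_eq_square)
    qed
    moreover have "?J / (m / p / k) = p * m * (k * (t + 2 * c * p\<^sup>2))"
      using assms(1,2,4) by (simp add: field_simps power2_eq_square)
    moreover have "p\<^sup>2 - t + ?J - ?S = p\<^sup>2 * (1 - 2 * t)"
      unfolding m by (simp add: algebra_simps)
    moreover have "m / p * (p\<^sup>2 * (1 - 2 * t)) = p * m * (1 - 2 * t)"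
      using assms(1) by (simp add: field_simps power2_eq_square)
    moreover have "(1 - 2 * t - p\<^sup>2 * (1 - 2 * t)) / (m / p) = p * m * (1 - 2 * t)"
    proof -
      have eq: "1 - 2 * t - p\<^sup>2 * (1 - 2 * t) = m\<^sup>2 * (1 - 2 * t)"
        unfolding m by (simp add: algebra_simps)
      show ?thesis
        unfolding eq using assms(1,2) by (simp add: field_simps power2_eq_square)
    qed
    ultimately have "?T ?S ?J = (p * m * (k * (t + 2 * c * m\<^sup>2)) + p * m * ((t - 2 * c * p\<^sup>2) / k)) / 2 +
        (p * m * (1 - 2 * t) + p * m * (1 - 2 * t)) / 2 +
        (p * m * ((t - 2 * c * m\<^sup>2) / k) + p * m * (k * (t + 2 * c * p\<^sup>2))) / 2"
      by simp
    also have "\<dots> = p * m * ((1 - 2 * t) + k * (t + c * (p\<^sup>2 + m\<^sup>2)) + (t - c * (p\<^sup>2 + m\<^sup>2)) / k)"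
      using assms(4) by (simp add: field_simps)
    finally show ?thesis
      using assms(3) by simp
  qed
  have "X \<le> R" if "X = Y - Z / 2" "0 \<le> Z" "Y = R" for X Y Z R :: real
    using that by simp
  from this[OF main nonneg min] show ?thesis .
qed

text \<open>By the arithmetic-geometric mean, \<open>k * (t + c) + (t - c) / k\<close> is least at
  \<open>k = sqrt ((t - c) / (t + c))\<close>, with value
  \<open>2 * sqrt (t^2 - c^2)\<close>.\<close>

lemma optimal_slope_ratio:
  fixes X f t c :: real
  assumes "0 \<le> f" "0 < c" "c \<le> t"
    and bound: "\<And>k. 0 < k \<Longrightarrow> k \<le> 1 \<Longrightarrow> X \<le> f * (1 - 2 * t + k * (t + c) + (t - c) / k)"
  shows "X \<le> f * (1 - 2 * (t - sqrt (t\<^sup>2 - c\<^sup>2)))"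
proof (cases "c = t")
  case False
  define u v where "u = sqrt (t - c)" and "v = sqrt (t + c)"
  have uv: "0 < u" "0 < v" "u \<le> v" "u\<^sup>2 = t - c" "v\<^sup>2 = t + c"
    using assms(2,3) False by (auto simp: u_def v_def)
  have "X \<le> f * (1 - 2 * t + (u / v * v\<^sup>2 + u\<^sup>2 / (u / v)))"
    using bound[of "u / v"] uv by (simp add: add.assoc)
  also have "u / v * v\<^sup>2 + u\<^sup>2 / (u / v) = 2 * (u * v)"
    using uv(1,2) by (auto simp: power2_eq_square)
  also have "u * v = sqrt (t\<^sup>2 - c\<^sup>2)"
    by (simp add: u_def v_def real_sqrt_mult[symmetric] power2_eq_square algebra_simps)
  finally show ?thesis by (simp add: algebra_simps)
next
  case True
  \<comment> \<open>The optimal ratio degenerates to 0 here.\<close>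
  have "X \<le> f * (1 - 2 * t)"
  proof (rule field_le_epsilon)
    fix e :: real
    assume e: "0 < e"
    \<comment> \<open>Small enough that the excess \<open>f * (2 * t) * k\<close> is at most
      \<open>e\<close>; the \<open>+ 1\<close> covers \<open>f = 0\<close>.\<close>
    define k where "k = min 1 (e / (f * (2 * t) + 1))"
    have d: "0 < f * (2 * t) + 1" using assms by (auto intro!: add_nonneg_pos)
    then have k: "0 < k" "k \<le> 1" using e by (auto simp: k_def)
    have "k * (f * (2 * t) + 1) \<le> e"
      using d unfolding pos_le_divide_eq[OF d, symmetric] by (simp add: k_def)
    then have "f * (2 * t) * k \<le> e"
      using k by (simp add: algebra_simps)
    then show "X \<le> f * (1 - 2 * t) + e"
      using bound[OF k] True by (simp add: algebra_simps)
  qed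
  with True show ?thesis by simp
qed

text \<open>The difference equals \<open>c^2 / (T + sqrt (T^2 - c^2))\<close>, which falls as
  \<open>T\<close> grows. It serves to replace the capped cut point by \<open>r / e\<close>.\<close>

lemma diff_sqrt_antimono:
  fixes c t T :: real
  assumes "0 \<le> c" "c \<le> t" "t \<le> T"
  shows "T - sqrt (T\<^sup>2 - c\<^sup>2) \<le> t - sqrt (t\<^sup>2 - c\<^sup>2)"
proof -
  let ?s = "sqrt (t\<^sup>2 - c\<^sup>2)"
  have c2: "c\<^sup>2 \<le> t\<^sup>2" using assms by (simp add: power_mono)
  have st: "?s \<le> t" using assms by (intro real_le_lsqrt) auto
  have "((T - t) + ?s)\<^sup>2 = (T - t)\<^sup>2 + 2 * (T - t) * ?s + (t\<^sup>2 - c\<^sup>2)"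
    using c2 by (simp add: power2_sum)
  also have "\<dots> \<le> (T - t)\<^sup>2 + 2 * (T - t) * t + (t\<^sup>2 - c\<^sup>2)"
    using st assms by (intro add_mono mult_left_mono) auto
  also have "\<dots> = T\<^sup>2 - c\<^sup>2" by (simp add: power2_eq_square algebra_simps)
  finally have "(T - t) + ?s \<le> sqrt (T\<^sup>2 - c\<^sup>2)" by (rule real_le_rsqrt)
  then show ?thesis by simp
qed

text \<open>Identifies the stated gap with the optimised one at \<open>t = r / e\<close> and
  \<open>c = 1 / (2 * e)\<close>.\<close>

lemma gap_formula:
  fixes r e :: real
  assumes "0 < r" "0 < e"
  shows "2 * (r / e) * (1 - sqrt (1 - 1 / (4 * r\<^sup>2))) =
    2 * (r / e - sqrt ((r / e)\<^sup>2 - (1 / (2 * e))\<^sup>2))"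
proof -
  have "(r / e)\<^sup>2 - (1 / (2 * e))\<^sup>2 = (r / e)\<^sup>2 * (1 - 1 / (4 * r\<^sup>2))"
    using assms by (simp add: field_simps power2_eq_square)
  then have "sqrt ((r / e)\<^sup>2 - (1 / (2 * e))\<^sup>2) = r / e * sqrt (1 - 1 / (4 * r\<^sup>2))"
    using assms by (simp add: real_sqrt_mult)
  then show ?thesis by (simp add: algebra_simps)
qed

text \<open>From \<open>sqrt (1 - x) \<le> 1 - x / 2\<close> at \<open>x = 1 / (4 * r^2)\<close>,
  where \<open>1 / 2 \<le> r\<close> ensures \<open>x \<le> 1\<close>.\<close>

lemma gap_formula_ge:
  fixes r e :: real
  assumes "1 / 2 \<le> r" "0 < e"
  shows "1 / (4 * r * e) \<le> 2 * (r / e) * (1 - sqrt (1 - 1 / (4 * r\<^sup>2)))"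
proof -
  define x where "x = 1 / (4 * r\<^sup>2)"
  have r2: "(1 / 2)\<^sup>2 \<le> r\<^sup>2" using assms by (intro power_mono) auto
  have x: "0 < x" "x \<le> 1"
    using r2 assms by (auto simp: x_def field_simps power2_eq_square)
  have "1 - x \<le> (1 - x / 2)\<^sup>2" by (simp add: power2_eq_square algebra_simps)
  then have "sqrt (1 - x) \<le> 1 - x / 2" using x by (intro real_le_lsqrt) auto
  then have "2 * (r / e) * (x / 2) \<le> 2 * (r / e) * (1 - sqrt (1 - x))"
    using assms by (intro mult_left_mono) auto
  moreover have "2 * (r / e) * (x / 2) = 1 / (4 * r * e)"
    using assms by (simp add: x_def field_simps power2_eq_square)
  ultimately show ?thesis unfolding x_def by simp
qed

locale lazy_positive_chain = positive_chain P \<pi>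
  for P :: "'v::finite \<Rightarrow> 'v \<Rightarrow> real" and \<pi> :: "'v \<Rightarrow> real" +
  assumes lazy: "lazy_chain P"
begin

section \<open>Laziness and flow bounds\<close>

lemma flow_inside: "y \<in> A \<Longrightarrow> \<pi> y / 2 \<le> ergodic_flow P \<pi> A y"
proof -
  assume "y \<in> A"
  have "\<pi> y * (1 / 2) \<le> \<pi> y * P y y"
    using lazy by (intro mult_left_mono) (auto simp: lazy_chain_def)
  also have "\<dots> \<le> ergodic_flow P \<pi> A y"
    unfolding ergodic_flow_def using \<open>y \<in> A\<close> member_le_sum[of y A "\<lambda>x. \<pi> x * P x y"] by simp
  finally show ?thesis by simp
qed

lemma flow_outside: "y \<notin> A \<Longrightarrow> ergodic_flow P \<pi> A y \<le> \<pi> y / 2"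
  using flow_inside[of y "- A"] by (simp add: flow_Compl)

text \<open>The interface between paths and evolving sets: \<open>F y\<close> stands for the mass of
  the pairs from \<open>A\<close> to its complement that are assigned to the entry point
  \<open>y\<close>. Ordered and unordered path systems both produce such an
  \<open>F\<close>.\<close>

definition flow_bound :: "real \<Rightarrow> real \<Rightarrow> bool" where
  "flow_bound r e \<longleftrightarrow> (\<forall>A. A \<noteq> {} \<longrightarrow> A \<noteq> UNIV \<longrightarrow>
     (\<exists>F. (\<forall>y\<in>- A. F y \<le> r * \<pi> y \<and> F y \<le> e * ergodic_flow P \<pi> A y) \<and>
          sum F (- A) = sum \<pi> A * (1 - sum \<pi> A)))"

lemma flow_boundE:
  assumes "flow_bound r e" "A \<noteq> {}" "A \<noteq> UNIV"
  obtains F where "\<And>y. y \<notin> A \<Longrightarrow> F y \<le> r * \<pi> y"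
    and "\<And>y. y \<notin> A \<Longrightarrow> F y \<le> e * ergodic_flow P \<pi> A y"
    and "sum F (- A) = sum \<pi> A * (1 - sum \<pi> A)"
  using assms unfolding flow_bound_def by (metis ComplI)

lemma singleton_neq_UNIV:
  assumes "2 \<le> CARD('v)"
  shows "{v :: 'v} \<noteq> UNIV"
proof
  assume "{v} = UNIV"
  then have "CARD('v) = card {v}" by simp
  with assms show False by simp
qed

text \<open>Take the complement of \<open>{v}\<close> as the set: the whole flow
  \<open>\<pi> v * (1 - \<pi> v)\<close> must enter at \<open>v\<close>, and by laziness
  \<open>v\<close> receives at most \<open>\<pi> v / 2\<close> from the other states.\<close>

lemma flow_bound_lower:
  assumes "flow_bound r e" "2 \<le> CARD('v)"
  shows "1 - \<pi> v \<le> r" "2 * (1 - \<pi> v) \<le> e"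
proof -
  have "- {v} \<noteq> {}" "- {v} \<noteq> UNIV"
    using singleton_neq_UNIV[OF assms(2), of v] by auto
  then obtain F where F: "F v \<le> r * \<pi> v" "F v \<le> e * ergodic_flow P \<pi> (- {v}) v"
    and s: "F v = (1 - \<pi> v) * \<pi> v"
    using assms(1) by (elim flow_boundE[of r e "- {v}"]) (auto simp: pi_Compl)
  show "1 - \<pi> v \<le> r" using F(1) unfolding s by simp
  have "0 < 1 - \<pi> v"
    using pi_set_less_1[OF singleton_neq_UNIV[OF assms(2), of v]] by simp
  then have "0 < e * ergodic_flow P \<pi> (- {v}) v"
    using F(2) unfolding s by (smt (verit) mult_pos_pos pi_pos)
  then have "0 < e" using flow_nonneg[of "- {v}" v] by (metis zero_less_mult_iff not_less)
  have "(1 - \<pi> v) * \<pi> v \<le> e * ergodic_flow P \<pi> (- {v}) v" using F(2) s by simp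
  also have "\<dots> \<le> e * (\<pi> v / 2)"
    using \<open>0 < e\<close> flow_outside[of v "- {v}"] by (intro mult_left_mono) auto
  finally have "(2 * (1 - \<pi> v)) * \<pi> v \<le> e * \<pi> v" by simp
  then show "2 * (1 - \<pi> v) \<le> e" by simp
qed

lemma ex_light_state:
  assumes "2 \<le> CARD('v)"
  shows "\<exists>v. \<pi> v \<le> 1 / 2"
proof -
  define x :: 'v where "x = undefined"
  obtain y where "y \<noteq> x" using singleton_neq_UNIV[OF assms, of x] by auto
  then have "\<pi> x + \<pi> y \<le> 1" using pi_set_le_1[of "{x, y}"] by simp
  then have "\<pi> x \<le> 1 / 2 \<or> \<pi> y \<le> 1 / 2" by linarith
  then show ?thesis by blast
qed

text \<open>For \<open>0 \<le> t\<close> this is the integral over \<open>[0,t]\<close> of the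
  measure of the evolved set, as \<open>has_integral_evolved_mass\<close> shows.\<close>

definition truncated_flow :: "'v set \<Rightarrow> real \<Rightarrow> real" where
  "truncated_flow A t = (\<Sum>y\<in>UNIV. min (t * \<pi> y) (ergodic_flow P \<pi> A y))"

lemma truncated_flow_0: "truncated_flow A 0 = 0"
  by (simp add: truncated_flow_def)

lemma truncated_flow_1: "truncated_flow A 1 = sum \<pi> A"
  by (simp add: truncated_flow_def min_absorb2 sum_flow)

text \<open>Reflecting \<open>u\<close> to \<open>1 - u\<close> exchanges \<open>A\<close> with its
  complement, so the piece \<open>[1-t,1]\<close> for \<open>A\<close> reduces to the piece
  \<open>[0,t]\<close> for \<open>- A\<close>.\<close>

lemma truncated_flow_Compl:
  "truncated_flow A (1 - t) = sum \<pi> A - t + truncated_flow (- A) t"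
proof -
  have "min ((1 - t) * \<pi> y) (ergodic_flow P \<pi> A y) =
      ergodic_flow P \<pi> A y - t * \<pi> y + min (t * \<pi> y) (ergodic_flow P \<pi> (- A) y)" for y
    by (simp add: flow_Compl min_def algebra_simps)
  then show ?thesis
    by (simp add: truncated_flow_def sum.distrib sum_subtractf sum_flow flip: sum_distrib_left)
qed

text \<open>Inside \<open>A\<close> laziness makes the minimum equal to \<open>t * \<pi> y\<close>.
  Outside \<open>A\<close> the value \<open>F y / e\<close> lies below both arguments of the
  minimum, and its sum is the surplus.\<close>

lemma truncated_flow_lower:
  assumes "flow_bound r e" "A \<noteq> {}" "A \<noteq> UNIV" "0 < e" "t \<le> 1 / 2" "t \<le> r / e" "t = 1 / 2 \<or> t = r / e"
  shows "t * sum \<pi> A + sum \<pi> A * (1 - sum \<pi> A) / e \<le> truncated_flow A t"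
proof -
  obtain F where F: "\<And>y. y \<notin> A \<Longrightarrow> F y \<le> r * \<pi> y"
      "\<And>y. y \<notin> A \<Longrightarrow> F y \<le> e * ergodic_flow P \<pi> A y"
    and s: "sum F (- A) = sum \<pi> A * (1 - sum \<pi> A)"
    using flow_boundE[OF assms(1-3)] by blast
  let ?m = "\<lambda>y. min (t * \<pi> y) (ergodic_flow P \<pi> A y)"
  have "truncated_flow A t = sum ?m A + sum ?m (- A)"
    unfolding truncated_flow_def using sum.subset_diff[of A UNIV ?m]
    by (simp add: Compl_eq_Diff_UNIV)
  moreover have "(\<Sum>y\<in>A. t * \<pi> y) \<le> sum ?m A"
  proof (rule sum_mono)
    fix y assume "y \<in> A"
    then have "t * \<pi> y \<le> ergodic_flow P \<pi> A y"
      using flow_inside[of y A] mult_right_mono[OF assms(5) pi_nonneg[of y]] by linarith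
    then show "t * \<pi> y \<le> ?m y" by simp
  qed
  moreover have "(\<Sum>y\<in>- A. F y / e) \<le> sum ?m (- A)"
  proof (rule sum_mono)
    fix y assume y: "y \<in> - A"
    then have 1: "F y / e \<le> ergodic_flow P \<pi> A y"
      using F(2)[of y] assms(4) by (simp add: field_simps)
    \<comment> \<open>At \<open>t = r / e\<close> this is the vertex bound; at
      \<open>t = 1 / 2\<close> it follows from the edge bound, since a state outside
      \<open>A\<close> gets at most half its mass from \<open>A\<close>.\<close>
    have "F y / e \<le> t * \<pi> y"
    proof (cases "t = r / e")
      case True
      then show ?thesis using F(1)[of y] y assms(4) by (simp add: pos_divide_le_eq mult_ac)
    next
      case False
      then have "t * \<pi> y = \<pi> y / 2" using assms(7) by simp
      then show ?thesis using 1 flow_outside[of y A] y by (metis ComplD order.trans)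
    qed
    with 1 show "F y / e \<le> ?m y" by simp
  qed
  ultimately show ?thesis
    by (simp add: s sum_distrib_left flip: sum_divide_distrib)
qed

lemma has_integral_evolved_mass:
  assumes "0 \<le> t"
  shows "((\<lambda>u. sum \<pi> (evolved_set P \<pi> A u)) has_integral truncated_flow A t) {0..t}"
proof -
  have "((\<lambda>u. \<Sum>y\<in>UNIV. \<pi> y * (if u \<le> ergodic_flow P \<pi> A y / \<pi> y then 1 else 0)) has_integral
      (\<Sum>y\<in>UNIV. \<pi> y * min t (ergodic_flow P \<pi> A y / \<pi> y))) {0..t}"
    using assms by (intro has_integral_sum has_integral_mult_right has_integral_threshold) auto
  moreover have "\<pi> y * min t (ergodic_flow P \<pi> A y / \<pi> y) = min (t * \<pi> y) (ergodic_flow P \<pi> A y)" for y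
    by (simp add: min_def field_simps)
  moreover have "(\<Sum>y\<in>UNIV. \<pi> y * (if u \<le> ergodic_flow P \<pi> A y / \<pi> y then 1 else 0)) =
      sum \<pi> (evolved_set P \<pi> A u)" for u
  proof -
    have "sum \<pi> (evolved_set P \<pi> A u) = (\<Sum>y\<in>UNIV. if y \<in> evolved_set P \<pi> A u then \<pi> y else 0)"
      by (simp add: sum.If_cases)
    also have "\<dots> = (\<Sum>y\<in>UNIV. \<pi> y * (if u \<le> ergodic_flow P \<pi> A y / \<pi> y then 1 else 0))"
      by (intro sum.cong) (auto simp: mem_evolved_set)
    finally show ?thesis by simp
  qed
  ultimately show ?thesis
    by (simp add: truncated_flow_def)
qed

text \<open>One tangent line replaces the integrand on \<open>[p,q]\<close>, so only the integral of
  the measure itself enters, a difference of values of \<open>truncated_flow\<close>.\<close>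

lemma integral_spread_le:
  assumes "0 \<le> p" "p \<le> q" "q \<le> 1" "0 < l"
  shows "integral {p..q} (\<lambda>u. spread (evolved_set P \<pi> A u)) \<le>
    (l * (truncated_flow A q - truncated_flow A p) +
      (q - p - (truncated_flow A q - truncated_flow A p)) / l) / 2"
proof -
  let ?g = "\<lambda>u. sum \<pi> (evolved_set P \<pi> A u)"
  let ?d = "truncated_flow A q - truncated_flow A p"
  have int: "?g integrable_on {p..q}"
    using has_integral_evolved_mass[of q A] assms
    by (rule_tac integrable_subinterval_real[of ?g 0 q]) (auto simp: has_integral_iff)
  have "integral {0..p} ?g + integral {p..q} ?g = integral {0..q} ?g"
    using has_integral_evolved_mass[of q A] assms
    by (rule_tac Henstock_Kurzweil_Integration.integral_combine) (auto simp: has_integral_iff)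
  then have "integral {p..q} ?g = ?d"
    using has_integral_evolved_mass[of q A] has_integral_evolved_mass[of p A] assms
    by (simp add: has_integral_iff)
  with int have g: "(?g has_integral ?d) {p..q}"
    by (simp add: has_integral_iff)
  have one: "((\<lambda>u. 1) has_integral (q - p)) {p..q}"
    using has_integral_const_real[of "1 :: real" p q] assms by simp
  have "((\<lambda>u. (l * ?g u + (1 - ?g u) / l) / 2) has_integral (l * ?d + (q - p - ?d) / l) / 2) {p..q}"
    by (intro has_integral_divide has_integral_add has_integral_mult_right has_integral_diff one g)
  moreover have "(\<lambda>u. spread (evolved_set P \<pi> A u)) integrable_on {p..q}"
    using evolved_set_has_integral[of spread A] assms
    by (rule_tac integrable_subinterval_real[of "\<lambda>u. spread (evolved_set P \<pi> A u)" 0 1])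
      (auto simp: has_integral_iff)
  then have "((\<lambda>u. spread (evolved_set P \<pi> A u)) has_integral
      integral {p..q} (\<lambda>u. spread (evolved_set P \<pi> A u))) {p..q}"
    by (rule integrable_integral)
  ultimately show ?thesis
    using sqrt_mult_le_weighted_mean[OF _ _ assms(4)] by (elim has_integral_le[rotated]) auto
qed

text \<open>By laziness the evolved set contains \<open>A\<close> for \<open>u \<le> 1/2\<close> and
  lies in \<open>A\<close> for \<open>u > 1/2\<close>. The middle line is therefore tangent at the
  measure of \<open>A\<close>, while the point of tangency moves up on \<open>[0,t]\<close> and down
  on \<open>[1-t,1]\<close>, both governed by the ratio \<open>k\<close> that is optimised at the
  end.\<close>

lemma integral_spread_bound:
  assumes "flow_bound r e" "A \<noteq> {}" "A \<noteq> UNIV" "0 < e" "1 / (2 * e) \<le> t"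
    and t: "t \<le> 1 / 2" "t \<le> r / e" "t = 1 / 2 \<or> t = r / e"
  shows "integral {0..1} (\<lambda>u. spread (evolved_set P \<pi> A u)) \<le>
    spread A * (1 - 2 * (t - sqrt (t\<^sup>2 - (1 / (2 * e))\<^sup>2)))"
proof (rule optimal_slope_ratio)
  let ?h = "\<lambda>u. spread (evolved_set P \<pi> A u)"
  define p m c where "p = sqrt (sum \<pi> A)" and "m = sqrt (1 - sum \<pi> A)" and "c = 1 / (2 * e)"
  have pm: "0 < p" "0 < m" "p\<^sup>2 = sum \<pi> A" "m\<^sup>2 = 1 - sum \<pi> A" "spread A = p * m"
    using pi_set_pos[OF assms(2)] pi_set_less_1[OF assms(3)]
    by (auto simp: p_def m_def real_sqrt_mult)
  have t0: "0 \<le> t"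
    using assms(4,5) by (smt (verit) divide_nonneg_pos)
  show "0 < 1 / (2 * e)" using assms(4) by simp
  fix k :: real
  assume k: "0 < k" "k \<le> 1"
  define S J where "S = truncated_flow A t" and "J = truncated_flow (- A) t"
  have "- A \<noteq> {}" "- A \<noteq> UNIV" using assms(2,3) by auto
  then have SJ: "t * p\<^sup>2 + 2 * c * p\<^sup>2 * m\<^sup>2 \<le> S" "t * m\<^sup>2 + 2 * c * p\<^sup>2 * m\<^sup>2 \<le> J"
    using truncated_flow_lower[OF assms(1) _ _ assms(4) t, of A] assms(2,3)
      truncated_flow_lower[OF assms(1) _ _ assms(4) t, of "- A"]
    by (auto simp: S_def J_def pm pi_Compl c_def mult_ac)
  have S2: "truncated_flow A (1 - t) = p\<^sup>2 - t + J"
    by (simp add: truncated_flow_Compl J_def pm)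
  have int: "?h integrable_on {0..1}"
    using evolved_set_has_integral[of spread A] by (auto simp: has_integral_iff)
  have "?h integrable_on {0..1 - t}"
    using int t0 by (rule_tac integrable_subinterval_real[of ?h 0 1]) auto
  then have "integral {0..1} ?h = integral {0..t} ?h + integral {t..1 - t} ?h + integral {1 - t..1} ?h"
    using t0 t(1) int
    by (simp add: Henstock_Kurzweil_Integration.integral_combine)
  also have "\<dots> \<le> (k * (m / p) * S + (t - S) / (k * (m / p))) / 2 +
      (m / p * (p\<^sup>2 - t + J - S) + (1 - 2 * t - (p\<^sup>2 - t + J - S)) / (m / p)) / 2 +
      (m / p / k * (t - J) + J / (m / p / k)) / 2"
    using integral_spread_le[of 0 t "k * (m / p)" A] integral_spread_le[of t "1 - t" "m / p" A]
      integral_spread_le[of "1 - t" 1 "m / p / k" A] t0 t(1) k pm(1,2)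
    by (intro add_mono) (simp_all add: truncated_flow_0 truncated_flow_1 S2 pm(3) flip: S_def)
  also have "\<dots> \<le> p * m * (1 - 2 * t + k * (t + c) + (t - c) / k)"
    using pm k SJ by (intro three_slope_bound) auto
  finally show "integral {0..1} ?h \<le> spread A * (1 - 2 * t + k * (t + 1 / (2 * e)) + (t - 1 / (2 * e)) / k)"
    by (simp add: pm(5) c_def)
qed (use assms in auto)

lemma C_sqrt_flow_bound:
  assumes "flow_bound r e" "2 \<le> CARD('v)"
  shows "2 * (r / e) * (1 - sqrt (1 - 1 / (4 * r\<^sup>2))) \<le> 1 - C_sqrt P \<pi>"
proof -
  obtain v where v: "\<pi> v \<le> 1 / 2" using ex_light_state[OF assms(2)] by blast
  then have re: "1 / 2 \<le> r" "1 \<le> e"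
    using flow_bound_lower[OF assms, of v] by auto
  \<comment> \<open>The cap \<open>1 / 2\<close> keeps \<open>[0,t]\<close> and
    \<open>[1-t,1]\<close> from overlapping and lets laziness apply on both.\<close>
  define t where "t = min (1 / 2) (r / e)"
  have t: "t \<le> 1 / 2" "t \<le> r / e" "t = 1 / 2 \<or> t = r / e" unfolding t_def by linarith+
  have ct: "1 / (2 * e) \<le> t" using re by (auto simp: t_def field_simps)
  let ?b = "1 - 2 * (t - sqrt (t\<^sup>2 - (1 / (2 * e))\<^sup>2))"
  have "C_sqrt P \<pi> \<le> ?b"
    unfolding C_sqrt_def evolving_set_constant_def
  proof (subst Max_le_iff)
    show "(\<lambda>A. integral {0..1} (\<lambda>u. spread (evolved_set P \<pi> A u)) / spread A) `
        {A. A \<noteq> {} \<and> A \<noteq> UNIV} \<noteq> {}"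
      using singleton_neq_UNIV[OF assms(2)] by auto
    show "\<forall>x\<in>(\<lambda>A. integral {0..1} (\<lambda>u. spread (evolved_set P \<pi> A u)) / spread A) `
        {A. A \<noteq> {} \<and> A \<noteq> UNIV}. x \<le> ?b"
    proof
      fix x
      assume "x \<in> (\<lambda>A. integral {0..1} (\<lambda>u. spread (evolved_set P \<pi> A u)) / spread A) `
        {A. A \<noteq> {} \<and> A \<noteq> UNIV}"
      then obtain A where A: "A \<noteq> {}" "A \<noteq> UNIV"
        and x: "x = integral {0..1} (\<lambda>u. spread (evolved_set P \<pi> A u)) / spread A"
        by blast
      show "x \<le> ?b"
        unfolding x using integral_spread_bound[OF assms(1) A _ ct t] re spread_pos[OF A]
        by (simp add: pos_divide_le_eq mult.commute)
    qed
  qed simp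
  \<comment> \<open>Undoing the cap can only make the gap smaller.\<close>
  moreover have "r / e - sqrt ((r / e)\<^sup>2 - (1 / (2 * e))\<^sup>2) \<le> t - sqrt (t\<^sup>2 - (1 / (2 * e))\<^sup>2)"
    using ct t re by (intro diff_sqrt_antimono) auto
  ultimately show ?thesis
    using gap_formula[of r e] re by simp
qed

end

section \<open>Flow bounds from paths\<close>

lemma is_path_append:
  "is_path P x (p @ p') z \<longleftrightarrow> (\<exists>y. is_path P x p y \<and> is_path P y p' z)"
  by (induction p arbitrary: x) auto

lemma is_path_subset_edges: "is_path P x p y \<Longrightarrow> set p \<subseteq> edges P"
  by (induction p arbitrary: x) auto

text \<open>The first edge whose head is outside \<open>A\<close> has its tail in
  \<open>A\<close>.\<close>

lemma is_path_crosses: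
  assumes "is_path P x p y" "x \<in> A" "y \<notin> A"
  shows "\<exists>e\<in>set p. fst e \<in> A \<and> snd e \<notin> A"
  using assms
proof (induction p arbitrary: x)
  case (Cons e p)
  then show ?case by (cases "snd e \<in> A") auto
qed simp

text \<open>The empty path has no \<open>path_vertices\<close>; distinct ends guarantee an edge, and
  then the first tail and the last head are the ends.\<close>

lemma path_vertices_endpoints:
  assumes "is_path P x p y" "x \<noteq> y"
  shows "x \<in> path_vertices p" "y \<in> path_vertices p"
proof -
  show "x \<in> path_vertices p"
    using assms by (cases p) (auto simp: path_vertices_def)
  show "y \<in> path_vertices p"
    using assms by (cases p rule: rev_cases) (auto simp: path_vertices_def is_path_append)
qed

lemma path_system_endpoints:
  assumes "path_system P \<Gamma>"
  shows "x \<noteq> y \<Longrightarrow> x \<in> path_vertices (\<Gamma> x y)" "y \<noteq> x \<Longrightarrow> x \<in> path_vertices (\<Gamma> x y)"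
    "x \<noteq> y \<Longrightarrow> y \<in> path_vertices (\<Gamma> x y)" "y \<noteq> x \<Longrightarrow> y \<in> path_vertices (\<Gamma> x y)"
  using assms path_vertices_endpoints[of P x "\<Gamma> x y" y] by (auto simp: path_system_def)

definition reverse_path :: "('v \<times> 'v) list \<Rightarrow> ('v \<times> 'v) list" where
  "reverse_path p = rev (map prod.swap p)"

lemma set_reverse_path [simp]: "set (reverse_path p) = prod.swap ` set p"
  by (simp add: reverse_path_def)

lemma path_vertices_reverse_path [simp]: "path_vertices (reverse_path p) = path_vertices p"
  by (auto simp: path_vertices_def image_image)

lemma is_path_reverse_path:
  assumes "\<And>u v. (u, v) \<in> edges P \<Longrightarrow> (v, u) \<in> edges P" "is_path P x p y"
  shows "is_path P y (reverse_path p) x"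
  using assms(2)
proof (induction p arbitrary: x)
  case (Cons e p)
  then show ?case
    using assms(1)[of "fst e" "snd e"]
    by (cases e) (auto simp: reverse_path_def is_path_append)
qed (simp add: reverse_path_def)

context lazy_positive_chain
begin

lemma edge_weight_pos: "e \<in> edges P \<Longrightarrow> 0 < edge_weight P \<pi> e"
  by (auto simp: edges_def edge_weight_def)

lemma sum_pairs: "(\<Sum>(x, z)\<in>A \<times> B. \<pi> x * \<pi> z) = sum \<pi> A * sum \<pi> B"
  by (simp add: sum_product sum.cartesian_product)

text \<open>For each pair from \<open>A\<close> to its complement one crossing edge of its path is
  selected, and \<open>F y\<close> collects the pairs whose edge ends at \<open>y\<close>. The total
  is exact because each pair is used once; the path visits \<open>y\<close>, which gives the vertex
  bound; splitting \<open>F y\<close> by the tail of the edge gives the edge bound.\<close>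

lemma flow_boundI:
  assumes paths: "path_system P \<Gamma>"
    and vertex: "\<And>A y. y \<notin> A \<Longrightarrow>
      (\<Sum>(x, z)\<in>{(x, z). x \<in> A \<and> z \<notin> A \<and> y \<in> path_vertices (\<Gamma> x z)}. \<pi> x * \<pi> z) \<le> r * \<pi> y"
    and edge: "\<And>A u y. (u, y) \<in> edges P \<Longrightarrow> u \<in> A \<Longrightarrow> y \<notin> A \<Longrightarrow>
      (\<Sum>(x, z)\<in>{(x, z). x \<in> A \<and> z \<notin> A \<and> (u, y) \<in> set (\<Gamma> x z)}. \<pi> x * \<pi> z)
        \<le> e * edge_weight P \<pi> (u, y)"
  shows "flow_bound r e"
  unfolding flow_bound_def
proof (intro allI impI)
  fix A :: "'v set"
  assume "A \<noteq> {}" "A \<noteq> UNIV"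
  let ?D = "A \<times> - A" and ?w = "\<lambda>(x, z). \<pi> x * \<pi> z"
  have "\<exists>g. \<forall>d\<in>?D. g d \<in> set (\<Gamma> (fst d) (snd d)) \<and> fst (g d) \<in> A \<and> snd (g d) \<notin> A"
  proof (intro bchoice ballI)
    fix d assume "d \<in> ?D"
    then have "fst d \<in> A" "snd d \<notin> A" "fst d \<noteq> snd d" by auto
    then show "\<exists>e. e \<in> set (\<Gamma> (fst d) (snd d)) \<and> fst e \<in> A \<and> snd e \<notin> A"
      using paths is_path_crosses[of P "fst d" "\<Gamma> (fst d) (snd d)" "snd d" A]
      unfolding path_system_def by blast
  qed
  then obtain g where g: "\<And>d. d \<in> ?D \<Longrightarrow> g d \<in> set (\<Gamma> (fst d) (snd d))"
      "\<And>d. d \<in> ?D \<Longrightarrow> fst (g d) \<in> A" "\<And>d. d \<in> ?D \<Longrightarrow> snd (g d) \<notin> A"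
    by blast
  define F where "F y = sum ?w {d \<in> ?D. snd (g d) = y}" for y
  have "sum F (- A) = sum ?w ?D"
    unfolding F_def using g(3) by (intro sum.group) auto
  then have total: "sum F (- A) = sum \<pi> A * (1 - sum \<pi> A)"
    by (simp add: sum_pairs pi_Compl)
  have "F y \<le> r * \<pi> y" if "y \<notin> A" for y
  proof -
    have "F y \<le> sum ?w {(x, z). x \<in> A \<and> z \<notin> A \<and> y \<in> path_vertices (\<Gamma> x z)}"
      unfolding F_def using g(1) by (intro sum_mono2) (fastforce simp: path_vertices_def)+
    with vertex[OF that] show ?thesis by linarith
  qed
  moreover have "F y \<le> e * ergodic_flow P \<pi> A y" if y: "y \<notin> A" for y
  proof -
    have "F y = (\<Sum>u\<in>A. sum ?w {d \<in> {d \<in> ?D. snd (g d) = y}. fst (g d) = u})"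
      unfolding F_def using g(2) by (intro sum.group[symmetric]) auto
    also have "\<dots> \<le> (\<Sum>u\<in>A. e * (\<pi> u * P u y))"
    proof (rule sum_mono)
      fix u assume u: "u \<in> A"
      let ?S = "{d \<in> {d \<in> ?D. snd (g d) = y}. fst (g d) = u}"
      have S: "(u, y) \<in> set (\<Gamma> (fst d) (snd d))" "fst d \<in> A" "snd d \<notin> A" if "d \<in> ?S" for d
        using g(1)[of d] that by (auto simp: prod_eq_iff)
      show "sum ?w ?S \<le> e * (\<pi> u * P u y)"
      proof (cases "(u, y) \<in> edges P")
        case True
        have "sum ?w ?S \<le> sum ?w {(x, z). x \<in> A \<and> z \<notin> A \<and> (u, y) \<in> set (\<Gamma> x z)}"
        proof (rule sum_mono2)
          show "?S \<subseteq> {(x, z). x \<in> A \<and> z \<notin> A \<and> (u, y) \<in> set (\<Gamma> x z)}"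
          proof
            fix d assume "d \<in> ?S"
            from S[OF this] show "d \<in> {(x, z). x \<in> A \<and> z \<notin> A \<and> (u, y) \<in> set (\<Gamma> x z)}"
              by (simp add: case_prod_beta)
          qed
        qed (simp_all add: case_prod_beta)
        also have "\<dots> \<le> e * (\<pi> u * P u y)"
          using edge[OF True u y] by (simp add: edge_weight_def)
        finally show ?thesis .
      next
        case False
        \<comment> \<open>Paths use only edges of positive probability, so no pair selects
          \<open>(u, y)\<close> and both sides are 0.\<close>
        have "d \<notin> ?S" for d
        proof
          assume d: "d \<in> ?S"
          from S(2,3)[OF d] have "fst d \<noteq> snd d" by auto
          then have "set (\<Gamma> (fst d) (snd d)) \<subseteq> edges P"
            using paths is_path_subset_edges unfolding path_system_def by blast
          with S(1)[OF d] False show False by blast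
        qed
        then have "?S = {}" by blast
        moreover have "P u y = 0"
          using False P_nonneg[of u y] by (simp add: edges_def)
        ultimately show ?thesis by (simp only: sum.empty)
      qed
    qed
    finally show ?thesis
      by (simp add: ergodic_flow_def sum_distrib_left)
  qed
  ultimately show "\<exists>F. (\<forall>y\<in>- A. F y \<le> r * \<pi> y \<and> F y \<le> e * ergodic_flow P \<pi> A y) \<and>
      sum F (- A) = sum \<pi> A * (1 - sum \<pi> A)"
    using total by blast
qed

lemma rho_e_ge:
  assumes "e \<in> edges P"
  shows "(\<Sum>(x, y)\<in>{(x, y). x \<noteq> y \<and> e \<in> set (\<Gamma> x y)}. \<pi> x * \<pi> y) \<le> rho_e P \<pi> \<Gamma> * edge_weight P \<pi> e"
proof -
  have "1 / edge_weight P \<pi> e * (\<Sum>(x, y)\<in>{(x, y). x \<noteq> y \<and> e \<in> set (\<Gamma> x y)}. \<pi> x * \<pi> y) \<le> rho_e P \<pi> \<Gamma>"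
    unfolding rho_e_def by (rule Max_ge) (use assms in auto)
  then show ?thesis
    using edge_weight_pos[OF assms] by (simp add: pos_divide_le_eq)
qed

lemma rho_v_ge:
  "(\<Sum>(x, y)\<in>{(x, y). x \<noteq> y \<and> v \<in> path_vertices (\<Gamma> x y)}. \<pi> x * \<pi> y) \<le> rho_v \<pi> \<Gamma> * \<pi> v"
proof -
  have "1 / \<pi> v * (\<Sum>(x, y)\<in>{(x, y). x \<noteq> y \<and> v \<in> path_vertices (\<Gamma> x y)}. \<pi> x * \<pi> y) \<le> rho_v \<pi> \<Gamma>"
    unfolding rho_v_def by (rule Max_ge) auto
  then show ?thesis
    by (simp add: pos_divide_le_eq)
qed

text \<open>A path loads both its ends, and the ordered pairs with \<open>v\<close> as one end have
  mass \<open>2 * \<pi> v * (1 - \<pi> v)\<close>.\<close>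

lemma rho_v_ge_endpoints:
  assumes paths: "path_system P \<Gamma>"
  shows "2 * (1 - \<pi> v) \<le> rho_v \<pi> \<Gamma>"
proof -
  let ?w = "\<lambda>(x, z). \<pi> x * \<pi> z"
  have "sum ?w ({v} \<times> - {v} \<union> (- {v}) \<times> {v}) = sum ?w ({v} \<times> - {v}) + sum ?w ((- {v}) \<times> {v})"
    by (intro sum.union_disjoint) auto
  then have "2 * (1 - \<pi> v) * \<pi> v = sum ?w ({v} \<times> - {v} \<union> (- {v}) \<times> {v})"
    unfolding sum_pairs by (simp add: pi_Compl)
  also have "\<dots> \<le> sum ?w {(x, y). x \<noteq> y \<and> v \<in> path_vertices (\<Gamma> x y)}"
    by (intro sum_mono2) (auto intro: path_system_endpoints[OF paths])
  also have "\<dots> \<le> rho_v \<pi> \<Gamma> * \<pi> v"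
    by (rule rho_v_ge)
  finally show ?thesis by simp
qed

text \<open>The paths that start at \<open>y\<close> load \<open>y\<close> without crossing the boundary of \<open>A\<close> towards \<open>y\<close>.
  This is why the vertex congestion can be lowered by \<open>1/2\<close>, which pays for the
  rounding of the mixing time to an integer.\<close>

lemma flow_bound_directed:
  assumes paths: "path_system P \<Gamma>" and card: "2 \<le> CARD('v)"
  shows "flow_bound (rho_v \<pi> \<Gamma> - 1 / 2) (rho_e P \<pi> \<Gamma>)"
  using paths
proof (rule flow_boundI)
  let ?w = "\<lambda>(x, z). \<pi> x * \<pi> z"
  fix A :: "'v set" and y
  assume y: "y \<notin> A"
  let ?X = "{(x, z). x \<in> A \<and> z \<notin> A \<and> y \<in> path_vertices (\<Gamma> x z)}"
  show "sum ?w ?X \<le> (rho_v \<pi> \<Gamma> - 1 / 2) * \<pi> y"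
  \<comment> \<open>For a light \<open>y\<close> the pairs starting at \<open>y\<close> have mass at
    least \<open>\<pi> y / 2\<close>. For a heavy one \<open>A\<close> has measure at most
    \<open>1 - \<pi> y < 1 / 2\<close>, a range where \<open>a * (1 - a)\<close> increases, and
    \<open>1 - \<pi> y \<le> rho_v \<pi> \<Gamma> - 1 / 2\<close>.\<close>
  proof (cases "\<pi> y \<le> 1 / 2")
    case True
    have "sum ?w ?X + sum ?w ({y} \<times> - {y}) = sum ?w (?X \<union> {y} \<times> - {y})"
      using y by (intro sum.union_disjoint[symmetric]) auto
    also have "\<dots> \<le> sum ?w {(x, z). x \<noteq> z \<and> y \<in> path_vertices (\<Gamma> x z)}"
      by (intro sum_mono2) (auto intro: path_system_endpoints[OF paths])
    also have "\<dots> \<le> rho_v \<pi> \<Gamma> * \<pi> y"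
      by (rule rho_v_ge)
    finally have "sum ?w ?X + \<pi> y * (1 - \<pi> y) \<le> rho_v \<pi> \<Gamma> * \<pi> y"
      unfolding sum_pairs by (simp add: pi_Compl)
    moreover have "\<pi> y * (1 / 2) \<le> \<pi> y * (1 - \<pi> y)"
      using True by (intro mult_left_mono) auto
    ultimately show ?thesis by (simp add: algebra_simps)
  next
    case False
    obtain v where "\<pi> v \<le> 1 / 2" using ex_light_state[OF card] by blast
    then have r: "1 \<le> rho_v \<pi> \<Gamma>" using rho_v_ge_endpoints[OF paths, of v] by simp
    have a: "sum \<pi> A \<le> 1 - \<pi> y"
      using sum_mono2[of "- {y}" A \<pi>] y by (auto simp: pi_Compl)
    have "sum ?w ?X \<le> sum ?w (A \<times> - A)"
      by (intro sum_mono2) auto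
    also have "\<dots> = sum \<pi> A * (1 - sum \<pi> A)"
      unfolding sum_pairs by (simp add: pi_Compl)
    also have "\<dots> \<le> (1 - \<pi> y) * \<pi> y"
    proof -
      have "0 \<le> (1 - \<pi> y - sum \<pi> A) * (\<pi> y - sum \<pi> A)"
        using a False by (intro mult_nonneg_nonneg) auto
      then show ?thesis by (simp add: algebra_simps)
    qed
    also have "\<dots> \<le> (rho_v \<pi> \<Gamma> - 1 / 2) * \<pi> y"
      using False r by (intro mult_right_mono) auto
    finally show ?thesis .
  qed
next
  let ?w = "\<lambda>(x, z). \<pi> x * \<pi> z"
  fix A :: "'v set" and u y
  assume e: "(u, y) \<in> edges P"
  have "sum ?w {(x, z). x \<in> A \<and> z \<notin> A \<and> (u, y) \<in> set (\<Gamma> x z)} \<le>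
      sum ?w {(x, z). x \<noteq> z \<and> (u, y) \<in> set (\<Gamma> x z)}"
    by (intro sum_mono2) auto
  with rho_e_ge[OF e, of \<Gamma>] show "sum ?w {(x, z). x \<in> A \<and> z \<notin> A \<and> (u, y) \<in> set (\<Gamma> x z)} \<le>
      rho_e P \<pi> \<Gamma> * edge_weight P \<pi> (u, y)"
    by linarith
qed

text \<open>The set \<open>A\<close> fixes the orientation: only one order of \<open>{x, z}\<close>
  goes from \<open>A\<close> to its complement, so passing to unordered pairs is injective.\<close>

lemma sum_crossing_pairs_le:
  assumes "\<And>x z. x \<in> A \<Longrightarrow> z \<notin> A \<Longrightarrow> R x z \<Longrightarrow> S {x, z}"
  shows "(\<Sum>(x, z)\<in>{(x, z). x \<in> A \<and> z \<notin> A \<and> R x z}. \<pi> x * \<pi> z) \<le>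
    (\<Sum>s\<in>{s \<in> unordered_pairs. S s}. prod \<pi> s)"
proof -
  let ?X = "{(x, z). x \<in> A \<and> z \<notin> A \<and> R x z}" and ?f = "\<lambda>(x, z). {x, z}"
  have "inj_on ?f ?X"
    by (auto simp: inj_on_def doubleton_eq_iff)
  then have "(\<Sum>s\<in>?f ` ?X. prod \<pi> s) = (\<Sum>d\<in>?X. prod \<pi> (?f d))"
    by (simp add: sum.reindex)
  also have "\<dots> = (\<Sum>(x, z)\<in>?X. \<pi> x * \<pi> z)"
  proof (rule sum.cong, simp, clarify)
    fix x z assume "x \<in> A" "z \<notin> A"
    then have "x \<noteq> z" by auto
    then show "prod \<pi> {x, z} = \<pi> x * \<pi> z" by simp
  qed
  finally have "(\<Sum>(x, z)\<in>?X. \<pi> x * \<pi> z) = (\<Sum>s\<in>?f ` ?X. prod \<pi> s)" by simp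
  also have "\<dots> \<le> (\<Sum>s\<in>{s \<in> unordered_pairs. S s}. prod \<pi> s)"
  proof (rule sum_mono2)
    show "?f ` ?X \<subseteq> {s \<in> unordered_pairs. S s}"
      using assms by (fastforce simp: unordered_pairs_def)
  qed (auto intro: prod_nonneg)
  finally show ?thesis .
qed

text \<open>Reversibility makes the edge set symmetric, so each stored path can be oriented as
  required; reversal keeps its vertices and its undirected edges.\<close>

lemma flow_bound_undirected:
  assumes rev: "reversible P \<pi>" and paths: "undirected_path_system P \<Delta>"
  shows "flow_bound (undirected_rho_v \<pi> \<Delta>) (undirected_rho_e P \<pi> \<Delta>)"
proof -
  define \<Gamma> where "\<Gamma> x y = (if is_path P x (\<Delta> {x, y}) y then \<Delta> {x, y} else reverse_path (\<Delta> {x, y}))"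
    for x y
  have sym: "(v, u) \<in> edges P" if "(u, v) \<in> edges P" for u v
  proof -
    have "0 < \<pi> v * P v u"
      using that rev by (metis (no_types, lifting) case_prodD edges_def mem_Collect_eq
          mult_pos_pos pi_pos reversible_def)
    from zero_less_mult_pos[OF this pi_pos] show ?thesis
      by (simp add: edges_def)
  qed
  have vertices: "path_vertices (\<Gamma> x y) = path_vertices (\<Delta> {x, y})" for x y
    by (simp add: \<Gamma>_def)
  have edge: "(u, v) \<in> set (\<Delta> {x, y}) \<or> (v, u) \<in> set (\<Delta> {x, y})"
    if "(u, v) \<in> set (\<Gamma> x y)" for u v x y
    using that unfolding \<Gamma>_def by (auto split: if_split_asm)
  have "path_system P \<Gamma>"
    using paths is_path_reverse_path[OF sym] unfolding path_system_def undirected_path_system_def \<Gamma>_def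
    by simp blast
  then show ?thesis
  proof (rule flow_boundI)
    fix A :: "'v set" and y
    let ?L = "\<Sum>s\<in>{s \<in> unordered_pairs. y \<in> path_vertices (\<Delta> s)}. prod \<pi> s"
    have "1 / \<pi> y * ?L \<le> undirected_rho_v \<pi> \<Delta>"
      unfolding undirected_rho_v_def by (rule Max_ge) auto
    then have "?L \<le> undirected_rho_v \<pi> \<Delta> * \<pi> y"
      by (simp add: pos_divide_le_eq)
    moreover have "(\<Sum>(x, z)\<in>{(x, z). x \<in> A \<and> z \<notin> A \<and> y \<in> path_vertices (\<Gamma> x z)}. \<pi> x * \<pi> z) \<le> ?L"
      unfolding vertices by (rule sum_crossing_pairs_le)
    ultimately show "(\<Sum>(x, z)\<in>{(x, z). x \<in> A \<and> z \<notin> A \<and> y \<in> path_vertices (\<Gamma> x z)}. \<pi> x * \<pi> z)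
        \<le> undirected_rho_v \<pi> \<Delta> * \<pi> y"
      by linarith
  next
    fix A :: "'v set" and u y
    assume e: "(u, y) \<in> edges P"
    let ?L = "\<Sum>s\<in>{s \<in> unordered_pairs. (u, y) \<in> set (\<Delta> s) \<or> (y, u) \<in> set (\<Delta> s)}. prod \<pi> s"
    have "1 / edge_weight P \<pi> (u, y) * ?L \<le> undirected_rho_e P \<pi> \<Delta>"
      unfolding undirected_rho_e_def
      by (rule Max_ge) (use e in \<open>auto intro!: image_eqI[of _ _ "(u, y)"]\<close>)
    then have "?L \<le> undirected_rho_e P \<pi> \<Delta> * edge_weight P \<pi> (u, y)"
      using edge_weight_pos[OF e] by (simp add: pos_divide_le_eq)
    moreover have "(\<Sum>(x, z)\<in>{(x, z). x \<in> A \<and> z \<notin> A \<and> (u, y) \<in> set (\<Gamma> x z)}. \<pi> x * \<pi> z) \<le> ?L"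
      using edge by (intro sum_crossing_pairs_le) blast
    ultimately show "(\<Sum>(x, z)\<in>{(x, z). x \<in> A \<and> z \<notin> A \<and> (u, y) \<in> set (\<Gamma> x z)}. \<pi> x * \<pi> z)
        \<le> undirected_rho_e P \<pi> \<Delta> * edge_weight P \<pi> (u, y)"
      by linarith
  qed
qed

end

section \<open>Mixing time\<close>

text \<open>Rounding down loses up to one step. With \<open>X = 4 * (r - 1 / 2) * e\<close> and
  \<open>L\<close> the logarithm, two gains make up for it: \<open>2 * e * L\<close> from lowering
  \<open>r\<close> by \<open>1 / 2\<close>, and \<open>X * q / 2\<close> from the factor
  \<open>sqrt (1 - q)\<close>. Their sum is at least 1 because \<open>\<epsilon> < 1 - q\<close>
  bounds \<open>L\<close> from below.\<close>

lemma rounded_mixing_bound: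
  fixes q \<epsilon> r e :: real
  assumes q: "0 < q" "q \<le> 1 / 2" and \<epsilon>: "0 < \<epsilon>" "\<epsilon> < 1 - q"
    and r: "2 * (1 - q) \<le> r" and e: "2 * (1 - q) \<le> e"
    and n: "4 * r * e * ln (1 / (2 * \<epsilon> * sqrt q)) \<le> real n + 1"
  shows "1 / 2 * (exp (- real n / (4 * (r - 1 / 2) * e)) * sqrt ((1 - q) / q)) \<le> \<epsilon>"
proof -
  define s where "s = sqrt q"
  have s: "0 < s" "s\<^sup>2 = q" using q by (auto simp: s_def)
  define L where "L = ln (1 / (2 * \<epsilon> * s))"
  have expL: "exp (- L) = 2 * \<epsilon> * s"
    using \<epsilon> s by (simp add: L_def ln_div exp_minus)
  have "- L \<le> 2 * \<epsilon> * s - 1"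
    using ln_le_minus_one[of "2 * \<epsilon> * s"] \<epsilon> s by (simp add: L_def ln_div)
  also have "2 * \<epsilon> * s \<le> 2 * (1 - q) * s"
    using \<epsilon> s by (intro mult_right_mono mult_left_mono) auto
  finally have L: "1 - 2 * (1 - q) * s \<le> L" by simp
  define X where "X = 4 * (r - 1 / 2) * e"
  have r1: "1 \<le> r" and e1: "1 \<le> e" using q r e by auto
  have X: "0 < X" using r1 e1 by (simp add: X_def)
  have "1 \<le> 2 * e * L + X * (q / 2)"
  proof -
    \<comment> \<open>The coefficient \<open>3 - 4 * q\<close> is the lower bound for
      \<open>2 * r - 1\<close>. The difference vanishes at \<open>s = 1 / 2\<close>, so the estimate
      is tight at \<open>q = 1 / 4\<close>.\<close>
    have "2 * (1 - 2 * (1 - q) * s) + (3 - 4 * q) * q - 1 = (1 - 2 * s)\<^sup>2 * (1 - s\<^sup>2)"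
      by (simp add: algebra_simps power2_eq_square flip: s(2))
    moreover have "0 \<le> (1 - 2 * s)\<^sup>2 * (1 - s\<^sup>2)"
      using q s by (intro mult_nonneg_nonneg) auto
    ultimately have "1 \<le> 2 * (1 - 2 * (1 - q) * s) + (3 - 4 * q) * q" by linarith
    also have "\<dots> \<le> 2 * L + (2 * r - 1) * q"
      using L r q by (intro add_mono mult_left_mono mult_right_mono) auto
    finally have "1 * 1 \<le> e * (2 * L + (2 * r - 1) * q)"
      using e1 by (intro mult_mono) auto
    then show ?thesis by (simp add: X_def algebra_simps)
  qed
  moreover have "X * L = 4 * r * e * L - 2 * e * L"
    by (simp add: X_def algebra_simps)
  ultimately have "X * L \<le> real n + X * (q / 2)"
    using n by (simp add: L_def s_def)
  then have "L \<le> real n / X + q / 2"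
    using X by (simp add: field_simps)
  then have "exp (- real n / X) * exp (- q / 2) \<le> exp (- L)"
    by (simp flip: exp_add)
  have "1 - q \<le> exp (- q)"
    using exp_ge_add_one_self[of "- q"] by simp
  then have "sqrt (1 - q) \<le> sqrt (exp (- q))" by simp
  also have "sqrt (exp (- q)) = exp (- q / 2)"
    by (rule real_sqrt_unique) (simp_all flip: exp_of_nat_mult)
  finally have "exp (- real n / X) * sqrt (1 - q) \<le> exp (- real n / X) * exp (- q / 2)"
    by (intro mult_left_mono) auto
  also have "\<dots> \<le> 2 * \<epsilon> * s" by (fold expL) fact
  finally show ?thesis
    using s(1) by (simp add: real_sqrt_divide X_def s_def field_simps)
qed

context lazy_positive_chain
begin

section \<open>Total variation and the number of steps\<close>

lemma pi_min_le: "pi_min \<pi> \<le> \<pi> x"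
  unfolding pi_min_def by (rule Min_le) auto

lemma pi_min_pos: "0 < pi_min \<pi>"
  unfolding pi_min_def by (subst Min_gr_iff) auto

lemma pi_min_le_half: "2 \<le> CARD('v) \<Longrightarrow> pi_min \<pi> \<le> 1 / 2"
  using ex_light_state pi_min_le order_trans by blast

lemma tv_distance_kernel_power:
  assumes "2 \<le> CARD('v)"
  shows "tv_distance (kernel_power P n x) \<pi> \<le>
    1 / 2 * (C_sqrt P \<pi> ^ n * sqrt ((1 - pi_min \<pi>) / pi_min \<pi>))"
proof -
  have "(1 - \<pi> x) / \<pi> x \<le> (1 - pi_min \<pi>) / pi_min \<pi>"
    using pi_min_le[of x] pi_min_pos pi_min_le_half[OF assms] by (intro frac_le) auto
  then have "C_sqrt P \<pi> ^ n * sqrt ((1 - \<pi> x) / \<pi> x) \<le> C_sqrt P \<pi> ^ n * sqrt ((1 - pi_min \<pi>) / pi_min \<pi>)"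
    using C_sqrt_nonneg[OF assms] by (intro mult_left_mono) auto
  with kernel_power_contraction[OF assms, of n x] show ?thesis
    by (simp add: tv_distance_def)
qed

lemma mixing_time_leI:
  assumes "\<And>x. tv_distance (kernel_power P n x) \<pi> \<le> \<epsilon>"
  shows "mixing_time P \<pi> \<epsilon> \<le> n"
  unfolding mixing_time_def by (rule Least_le) (use assms in simp)

text \<open>Since \<open>C_sqrt P \<pi> \<le> 1 - 1 / X \<le> exp (- 1 / X)\<close>,
  \<open>n\<close> steps contract by \<open>exp (- real n / X)\<close>.\<close>

lemma mixing_time_le:
  assumes "2 \<le> CARD('v)" "0 < X" "1 / X \<le> 1 - C_sqrt P \<pi>"
    and \<epsilon>: "1 / 2 * (exp (- real n / X) * sqrt ((1 - pi_min \<pi>) / pi_min \<pi>)) \<le> \<epsilon>"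
  shows "mixing_time P \<pi> \<epsilon> \<le> n"
proof (rule mixing_time_leI)
  fix x
  have "C_sqrt P \<pi> \<le> 1 + - 1 / X" using assms(3) by simp
  also have "\<dots> \<le> exp (- 1 / X)" by (rule exp_ge_add_one_self)
  finally have "C_sqrt P \<pi> ^ n \<le> exp (- 1 / X) ^ n"
    using C_sqrt_nonneg[OF assms(1)] by (intro power_mono)
  also have "\<dots> = exp (- real n / X)"
    by (simp flip: exp_of_nat_mult)
  finally have "1 / 2 * (C_sqrt P \<pi> ^ n * sqrt ((1 - pi_min \<pi>) / pi_min \<pi>)) \<le>
      1 / 2 * (exp (- real n / X) * sqrt ((1 - pi_min \<pi>) / pi_min \<pi>))"
    using pi_min_pos pi_min_le_half[OF assms(1)] by (intro mult_left_mono mult_right_mono) auto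
  with tv_distance_kernel_power[OF assms(1), of n x] \<epsilon>
  show "tv_distance (kernel_power P n x) \<pi> \<le> \<epsilon>" by linarith
qed

text \<open>The lightest state is the worst start, so the mixing time is 0 once
  \<open>\<epsilon>\<close> reaches \<open>1 - pi_min \<pi>\<close>.\<close>

lemma tv_distance_start: "tv_distance (kernel_power P 0 x) \<pi> = 1 - \<pi> x"
proof -
  have "(\<Sum>y\<in>UNIV. \<bar>kernel_power P 0 x y - \<pi> y\<bar>) =
      (\<Sum>y\<in>UNIV. \<pi> y + (if y = x then 1 - 2 * \<pi> x else 0))"
    using pi_set_le_1[of "{x}"] by (intro sum.cong) auto
  then show ?thesis
    by (simp add: tv_distance_def sum.distrib del: kernel_power.simps)
qed

text \<open>With no slack assumed in \<open>r\<close>, the number of steps is rounded up; the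
  ceiling appears for this reason.\<close>

lemma mixing_time_flow_bound:
  assumes "flow_bound r e" "2 \<le> CARD('v)" "0 < \<epsilon>" "2 * \<epsilon> * sqrt (pi_min \<pi>) \<le> 1"
  shows "int (mixing_time P \<pi> \<epsilon>) \<le> \<lceil>4 * r * e * ln (1 / (2 * \<epsilon> * sqrt (pi_min \<pi>)))\<rceil>"
proof -
  let ?q = "pi_min \<pi>"
  obtain v where v: "\<pi> v \<le> 1 / 2" using ex_light_state[OF assms(2)] by blast
  then have re: "1 / 2 \<le> r" "1 \<le> e"
    using flow_bound_lower[OF assms(1,2), of v] by auto
  define L X where "L = ln (1 / (2 * \<epsilon> * sqrt ?q))" and "X = 4 * r * e"
  define n where "n = nat \<lceil>X * L\<rceil>"
  have pos: "0 < 2 * \<epsilon> * sqrt ?q" using assms(3) pi_min_pos by simp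
  then have "exp L = 1 / (2 * \<epsilon> * sqrt ?q)"
    unfolding L_def by (intro exp_ln) simp
  then have L: "exp (- L) = 2 * \<epsilon> * sqrt ?q"
    by (simp add: exp_minus)
  have "0 \<le> L"
    unfolding L_def using pos assms(4) by (intro ln_ge_zero) (simp add: pos_le_divide_eq)
  have X: "0 < X" using re by (simp add: X_def)
  have "X * L \<le> real n" by (simp add: n_def real_nat_ceiling_ge)
  then have "- real n / X \<le> - L" using X by (simp add: field_simps)
  then have "exp (- real n / X) \<le> 2 * \<epsilon> * sqrt ?q" by (simp flip: L)
  then have "exp (- real n / X) * sqrt ((1 - ?q) / ?q) \<le> 2 * \<epsilon> * sqrt ?q * sqrt ((1 - ?q) / ?q)"
    using pi_min_pos pi_min_le_half[OF assms(2)] by (intro mult_right_mono) auto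
  also have "\<dots> = 2 * \<epsilon> * sqrt (1 - ?q)"
    using pi_min_pos by (simp add: real_sqrt_divide)
  also have "\<dots> \<le> 2 * \<epsilon> * 1"
    using assms(3) pi_min_pos by (intro mult_left_mono) auto
  finally have "1 / 2 * (exp (- real n / X) * sqrt ((1 - ?q) / ?q)) \<le> \<epsilon>" by simp
  moreover have "1 / X \<le> 1 - C_sqrt P \<pi>"
    using gap_formula_ge[of r e] C_sqrt_flow_bound[OF assms(1,2)] re by (simp add: X_def)
  ultimately have "mixing_time P \<pi> \<epsilon> \<le> n"
    using X by (intro mixing_time_le[OF assms(2)])
  moreover have "0 \<le> X * L"
    using X \<open>0 \<le> L\<close> by simp
  then have "int n = \<lceil>X * L\<rceil>"
    unfolding n_def by (intro nat_0_le) linarith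
  ultimately show ?thesis by (simp add: X_def L_def)
qed

text \<open>The flow bound holds here with \<open>r - 1 / 2\<close>, and this slack allows rounding
  down. Large \<open>\<epsilon>\<close> is treated apart, since \<open>rounded_mixing_bound\<close>
  requires \<open>\<epsilon> < 1 - pi_min \<pi>\<close>.\<close>

lemma mixing_time_flow_bound_rounded:
  assumes "flow_bound (r - 1 / 2) e" "2 \<le> CARD('v)" "\<And>v. 2 * (1 - \<pi> v) \<le> r"
    and "0 < \<epsilon>" "2 * \<epsilon> * sqrt (pi_min \<pi>) \<le> 1"
  shows "real (mixing_time P \<pi> \<epsilon>) \<le> 4 * r * e * ln (1 / (2 * \<epsilon> * sqrt (pi_min \<pi>)))"
proof -
  let ?q = "pi_min \<pi>"
  define L where "L = ln (1 / (2 * \<epsilon> * sqrt ?q))"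
  have pos: "0 < 2 * \<epsilon> * sqrt ?q" using assms(4) pi_min_pos by simp
  then have L: "0 \<le> L" using assms(5) by (auto simp: L_def ln_div)
  \<comment> \<open>The minimum is attained, so the lower bounds on \<open>r\<close> and
    \<open>e\<close> at that state hold with \<open>?q\<close>.\<close>
  have "pi_min \<pi> \<in> range \<pi>"
    unfolding pi_min_def by (rule Min_in) auto
  then obtain v where v: "\<pi> v = ?q" by auto
  have q: "0 < ?q" "?q \<le> 1 / 2" using pi_min_pos pi_min_le_half[OF assms(2)] by auto
  have re: "2 * (1 - ?q) \<le> r" "2 * (1 - ?q) \<le> e"
    using assms(3)[of v] flow_bound_lower(2)[OF assms(1,2), of v] v by auto
  then have re1: "1 \<le> r" "1 \<le> e" using q by auto
  show ?thesis
  proof (cases "\<epsilon> < 1 - ?q")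
    case False
    have "mixing_time P \<pi> \<epsilon> \<le> 0"
    proof (rule mixing_time_leI)
      fix x
      show "tv_distance (kernel_power P 0 x) \<pi> \<le> \<epsilon>"
        unfolding tv_distance_start using False pi_min_le[of x] by linarith
    qed
    moreover have "0 \<le> 4 * r * e * L" using re1 L by simp
    ultimately show ?thesis by (simp add: L_def)
  next
    case True
    define n where "n = nat \<lfloor>4 * r * e * L\<rfloor>"
    have "0 \<le> 4 * r * e * L" using re1 L by simp
    then have n: "real n \<le> 4 * r * e * L" "4 * r * e * L \<le> real n + 1"
      unfolding n_def by linarith+
    have "1 / (4 * (r - 1 / 2) * e) \<le> 1 - C_sqrt P \<pi>"
      using gap_formula_ge[of "r - 1 / 2" e] C_sqrt_flow_bound[OF assms(1,2)] re1 by simp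
    then have "mixing_time P \<pi> \<epsilon> \<le> n"
      using rounded_mixing_bound[OF q assms(4) True re n(2)[unfolded L_def]] re1
      by (intro mixing_time_le[OF assms(2)]) auto
    with n(1) show ?thesis by (simp add: L_def)
  qed
qed

end

section \<open>Spectral gap\<close>

lemma poly_det:
  fixes A :: "'a::comm_ring_1 poly ^ 'n::finite ^ 'n"
  shows "poly (det A) x = det (\<chi> i j. poly (A $ i $ j) x)"
  by (simp add: det_def poly_sum poly_prod)

lemma det_zero_iff_kernel:
  fixes A :: "'a::field ^ 'n::finite ^ 'n"
  shows "det A = 0 \<longleftrightarrow> (\<exists>v. v \<noteq> 0 \<and> A *v v = 0)"
  using invertible_det_nz[of A] matrix_left_invertible_ker[of A] invertible_left_inverse[of A] by auto

text \<open>By linearity in row \<open>k\<close> the determinant splits over \<open>l\<close>; for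
  \<open>l \<noteq> k\<close> two rows coincide.\<close>

lemma det_row_combination:
  fixes a :: "'n::finite \<Rightarrow> 'a::comm_ring_1 ^ 'n"
  shows "det (\<chi> i. if i = k then \<Sum>l\<in>UNIV. c l *s a l else a i) = c k * det (\<chi> i. a i)"
proof -
  have "det (\<chi> i. if i = k then \<Sum>l\<in>UNIV. c l *s a l else a i) =
      (\<Sum>l\<in>UNIV. c l * det (\<chi> i. if i = k then a l else a i))"
    by (simp add: det_linear_row_sum[of UNIV k "\<lambda>_ l. c l *s a l"] det_row_mul)
  also have "\<dots> = (\<Sum>l\<in>UNIV. if l = k then c k * det (\<chi> i. a i) else 0)"
  proof (intro sum.cong refl)
    fix l
    show "c l * det (\<chi> i. if i = k then a l else a i) = (if l = k then c k * det (\<chi> i. a i) else 0)"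
    proof (cases "l = k")
      case True
      then have "(\<lambda>i. if i = k then a l else a i) = a" by auto
      with True show ?thesis by simp
    next
      case False
      then have "det (\<chi> i. if i = k then a l else a i) = 0"
        by (intro det_identical_rows[of k l]) (simp_all add: row_def vec_eq_iff)
      with False show ?thesis by simp
    qed
  qed
  finally show ?thesis by simp
qed

text \<open>Index 1 is the second largest entry. If it equals \<open>a\<close>, the largest entry
  differs from \<open>a\<close> by multiplicity, hence is at most \<open>c\<close>, and it dominates
  entry 1.\<close>

lemma second_largest_le:
  fixes M :: "real multiset"
  assumes "2 \<le> size M" "count M a \<le> 1" "\<And>x. x \<in># M \<Longrightarrow> x \<noteq> a \<Longrightarrow> x \<le> c"
  shows "rev (sorted_list_of_multiset M) ! 1 \<le> c"
proof -
  define xs where "xs = rev (sorted_list_of_multiset M)"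
  have M: "M = mset xs" by (simp add: xs_def)
  have "sorted (rev xs)" by (simp add: xs_def)
  moreover have "2 \<le> length xs" using assms(1) by (simp add: M)
  then obtain x y ys where xs: "xs = x # y # ys"
    by (cases xs; cases "tl xs") auto
  ultimately have "y \<le> x" by (simp add: sorted_append)
  have "y \<le> c"
  proof (cases "y = a")
    case True
    then have "x \<noteq> a" using assms(2) by (auto simp: M xs)
    with assms(3)[of x] \<open>y \<le> x\<close> show ?thesis by (simp add: M xs)
  next
    case False
    with assms(3)[of y] show ?thesis by (simp add: M xs)
  qed
  then show ?thesis by (simp add: xs flip: xs_def)
qed

text \<open>If \<open>a\<close> were positive, a small negative \<open>t\<close> would make the
  quadratic negative.\<close>

lemma nonneg_quadratic_linear_coeff:
  fixes a c :: real
  assumes "\<And>t. 0 \<le> 2 * t * a + t\<^sup>2 * c" "0 \<le> a"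
  shows "a = 0"
proof (rule ccontr)
  assume "a \<noteq> 0"
  define d where "d = \<bar>c\<bar> + 1"
  have d: "0 < d" "c < d" by (auto simp: d_def)
  have "0 \<le> 2 * (- a / d) * a + (- a / d)\<^sup>2 * c" by (rule assms(1))
  also have "\<dots> = (a / d)\<^sup>2 * (c - 2 * d)"
    using d by (simp add: field_simps power2_eq_square)
  also have "\<dots> < 0"
    using \<open>a \<noteq> 0\<close> d by (intro mult_pos_neg) auto
  finally show False by simp
qed

context positive_chain
begin

section \<open>The kernel as an operator on functions\<close>

definition apply_kernel :: "('v \<Rightarrow> real) \<Rightarrow> 'v \<Rightarrow> real" where
  "apply_kernel f x = (\<Sum>y\<in>UNIV. P x y * f y)"

definition inner_pi :: "('v \<Rightarrow> real) \<Rightarrow> ('v \<Rightarrow> real) \<Rightarrow> real" where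
  "inner_pi f g = (\<Sum>x\<in>UNIV. \<pi> x * f x * g x)"

lemma mean_apply_kernel: "(\<Sum>x\<in>UNIV. \<pi> x * apply_kernel f x) = (\<Sum>x\<in>UNIV. \<pi> x * f x)"
proof -
  have "(\<Sum>x\<in>UNIV. \<pi> x * apply_kernel f x) = (\<Sum>y\<in>UNIV. (\<Sum>x\<in>UNIV. \<pi> x * P x y) * f y)"
    by (simp add: apply_kernel_def sum_distrib_left sum_distrib_right mult.assoc) (rule sum.swap)
  then show ?thesis by (simp add: pi_P)
qed

lemma inner_pi_pos: "f \<noteq> (\<lambda>_. 0) \<Longrightarrow> 0 < inner_pi f f"
proof -
  assume "f \<noteq> (\<lambda>_. 0)"
  then obtain x where "f x \<noteq> 0" by auto
  then show ?thesis
    unfolding inner_pi_def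
    by (intro sum_pos2[of UNIV x]) (auto simp: mult.assoc zero_less_mult_iff not_less order.strict_iff_order)
qed

lemma inner_pi_apply_kernel:
  assumes "reversible P \<pi>"
  shows "inner_pi f (apply_kernel g) = inner_pi g (apply_kernel f)"
proof -
  have "inner_pi f (apply_kernel g) = (\<Sum>x\<in>UNIV. \<Sum>y\<in>UNIV. (\<pi> x * P x y) * (f x * g y))"
    by (simp add: inner_pi_def apply_kernel_def sum_distrib_left mult_ac)
  also have "\<dots> = (\<Sum>x\<in>UNIV. \<Sum>y\<in>UNIV. (\<pi> y * P y x) * (f x * g y))"
    using assms by (simp add: reversible_def)
  also have "\<dots> = (\<Sum>y\<in>UNIV. \<Sum>x\<in>UNIV. (\<pi> y * P y x) * (f x * g y))"
    by (rule sum.swap)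
  also have "\<dots> = inner_pi g (apply_kernel f)"
    by (simp add: inner_pi_def apply_kernel_def sum_distrib_left mult_ac)
  finally show ?thesis .
qed

lemma eigenfunction_kernel_power:
  assumes "apply_kernel f = (\<lambda>x. \<mu> * f x)"
  shows "(\<Sum>y\<in>UNIV. kernel_power P n x y * f y) = \<mu> ^ n * f x"
proof (induction n arbitrary: x)
  case 0
  then show ?case by (simp add: if_distrib if_distribR cong: if_cong)
next
  case (Suc n)
  have "(\<Sum>y\<in>UNIV. kernel_power P (Suc n) x y * f y) =
      (\<Sum>z\<in>UNIV. P x z * (\<Sum>y\<in>UNIV. kernel_power P n z y * f y))"
    by (simp add: sum_distrib_left sum_distrib_right mult.assoc) (rule sum.swap)
  also have "\<dots> = (\<Sum>z\<in>UNIV. P x z * (\<mu> ^ n * f z))"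
    by (simp only: Suc)
  also have "\<dots> = \<mu> ^ n * apply_kernel f x"
    by (simp add: apply_kernel_def sum_distrib_left mult_ac)
  finally show ?case by (simp add: assms)
qed

text \<open>Mean zero lets \<open>\<pi>\<close> be subtracted from the \<open>n\<close>-step kernel,
  so applying it to \<open>f\<close> gives at most a constant times
  \<open>C_sqrt P \<pi> ^ n\<close> at \<open>x\<close>. The value is
  \<open>\<mu> ^ n * f x\<close>, so a larger \<open>\<bar>\<mu>\<bar>\<close> would force
  \<open>f x = 0\<close>.\<close>

lemma eigenvalue_le_C_sqrt:
  assumes "2 \<le> CARD('v)" "apply_kernel f = (\<lambda>x. \<mu> * f x)"
    and mean: "(\<Sum>x\<in>UNIV. \<pi> x * f x) = 0" and "f x \<noteq> 0"
  shows "\<bar>\<mu>\<bar> \<le> C_sqrt P \<pi>"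
proof (rule ccontr)
  assume "\<not> \<bar>\<mu>\<bar> \<le> C_sqrt P \<pi>"
  then have less: "C_sqrt P \<pi> < \<bar>\<mu>\<bar>" by simp
  define K where "K = sqrt ((1 - \<pi> x) / \<pi> x) * (\<Sum>y\<in>UNIV. \<bar>f y\<bar>)"
  have bound: "\<bar>\<mu>\<bar> ^ n * \<bar>f x\<bar> \<le> C_sqrt P \<pi> ^ n * K" for n
  proof -
    let ?D = "\<lambda>y. kernel_power P n x y - \<pi> y"
    have "\<mu> ^ n * f x = (\<Sum>y\<in>UNIV. ?D y * f y)"
      using eigenfunction_kernel_power[OF assms(2), of n x] mean
      by (simp add: left_diff_distrib sum_subtractf)
    then have "\<bar>\<mu>\<bar> ^ n * \<bar>f x\<bar> = \<bar>\<Sum>y\<in>UNIV. ?D y * f y\<bar>"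
      by (metis abs_mult power_abs)
    also have "\<dots> \<le> (\<Sum>y\<in>UNIV. \<bar>?D y * f y\<bar>)" by (rule sum_abs)
    also have "\<dots> \<le> (\<Sum>y\<in>UNIV. \<bar>?D y\<bar> * (\<Sum>z\<in>UNIV. \<bar>f z\<bar>))"
      unfolding abs_mult by (intro sum_mono mult_left_mono member_le_sum) auto
    also have "\<dots> = (\<Sum>y\<in>UNIV. \<bar>?D y\<bar>) * (\<Sum>z\<in>UNIV. \<bar>f z\<bar>)"
      by (simp add: sum_distrib_right)
    also have "\<dots> \<le> (C_sqrt P \<pi> ^ n * sqrt ((1 - \<pi> x) / \<pi> x)) * (\<Sum>z\<in>UNIV. \<bar>f z\<bar>)"
      by (intro mult_right_mono kernel_power_contraction assms(1)) (simp add: sum_nonneg)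
    finally show ?thesis by (simp add: K_def mult.assoc)
  qed
  have pos: "0 < \<bar>\<mu>\<bar>" using less C_sqrt_nonneg[OF assms(1)] by linarith
  have "\<bar>f x\<bar> \<le> (C_sqrt P \<pi> / \<bar>\<mu>\<bar>) ^ n * K" for n
    using bound[of n] pos by (simp add: power_divide field_simps)
  moreover have "(\<lambda>n. (C_sqrt P \<pi> / \<bar>\<mu>\<bar>) ^ n * K) \<longlonglongrightarrow> 0 * K"
    using less pos C_sqrt_nonneg[OF assms(1)]
    by (intro tendsto_mult LIMSEQ_realpow_zero tendsto_const) auto
  ultimately have "\<bar>f x\<bar> \<le> 0 * K"
    by (intro LIMSEQ_le_const) auto
  with assms(4) show False by simp
qed

text \<open>Supplies a second real eigenvalue, so that entry 1 of the eigenvalue list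
  exists.\<close>

lemma ex_second_eigenfunction:
  assumes "2 \<le> CARD('v)" "reversible P \<pi>"
  obtains f \<mu> x where "apply_kernel f = (\<lambda>x. \<mu> * f x)" "(\<Sum>x\<in>UNIV. \<pi> x * f x) = 0" "f x \<noteq> 0"
proof -
  \<comment> \<open>The eigenfunction maximises the Rayleigh quotient on the mean-zero functions.\<close>
  define S :: "(real ^ 'v) set" where
    "S = {v. (\<Sum>x\<in>UNIV. \<pi> x * v $ x) = 0 \<and> inner_pi (($) v) (($) v) = 1}"
  have "closed S"
    unfolding S_def inner_pi_def
    by (intro closed_Collect_conj closed_Collect_eq continuous_intros)
  moreover have "bounded S"
  proof -
    have "norm v \<le> (\<Sum>x\<in>UNIV. 1 / sqrt (\<pi> x))" if "v \<in> S" for v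
    proof -
      have "\<bar>v $ x\<bar> \<le> 1 / sqrt (\<pi> x)" for x
      proof -
        have "\<pi> x * v $ x * v $ x \<le> 1"
          using that member_le_sum[of x UNIV "\<lambda>x. \<pi> x * v $ x * v $ x"]
          by (simp add: S_def inner_pi_def mult.assoc)
        then have "(v $ x)\<^sup>2 \<le> 1 / \<pi> x"
          by (simp add: field_simps power2_eq_square)
        then have "sqrt ((v $ x)\<^sup>2) \<le> sqrt (1 / \<pi> x)"
          by (rule real_sqrt_le_mono)
        then show ?thesis by (simp add: real_sqrt_divide)
      qed
      then show ?thesis
        using norm_le_l1_cart[of v] sum_mono[of UNIV "\<lambda>x. \<bar>v $ x\<bar>" "\<lambda>x. 1 / sqrt (\<pi> x)"]
        by (meson order_trans)
    qed
    then show ?thesis by (auto simp: bounded_iff)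
  qed
  ultimately have "compact S" by (simp add: compact_eq_bounded_closed)
  have normalise: "\<exists>v\<in>S. \<forall>x. h x = sqrt (inner_pi h h) * v $ x"
    if h: "(\<Sum>x\<in>UNIV. \<pi> x * h x) = 0" "h \<noteq> (\<lambda>_. 0)" for h
  proof -
    let ?n = "sqrt (inner_pi h h)"
    have n: "0 < ?n" using inner_pi_pos[OF h(2)] by simp
    let ?v = "\<chi> x. h x / ?n"
    have "(\<Sum>x\<in>UNIV. \<pi> x * (h x / ?n)) = 0"
      using h(1) by (simp flip: sum_divide_distrib)
    moreover have "inner_pi (($) ?v) (($) ?v) = inner_pi h h / (?n * ?n)"
      by (simp add: inner_pi_def sum_divide_distrib)
    then have "inner_pi (($) ?v) (($) ?v) = 1"
      using inner_pi_pos[OF h(2)] by simp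
    ultimately have "?v \<in> S" by (simp add: S_def)
    moreover have "\<forall>x. h x = ?n * ?v $ x" using n by simp
    ultimately show ?thesis by blast
  qed
  define x0 :: 'v where "x0 = undefined"
  \<comment> \<open>A centred indicator: a nonzero function of mean zero, which shows that
    \<open>S\<close> is not empty.\<close>
  define h0 where "h0 y = (if y = x0 then 1 else 0) - \<pi> x0" for y
  have "(\<Sum>x\<in>UNIV. \<pi> x * h0 x) = (\<Sum>x\<in>UNIV. (if x = x0 then \<pi> x else 0) - \<pi> x * \<pi> x0)"
    by (intro sum.cong) (auto simp: h0_def algebra_simps)
  then have "(\<Sum>x\<in>UNIV. \<pi> x * h0 x) = 0"
    by (simp add: sum_subtractf flip: sum_distrib_right)
  moreover obtain y where "y \<noteq> x0"
    using assms(1) by (metis card_1_singleton_iff One_nat_def Suc_n_not_le_n UNIV_eq_I insertCI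
        numeral_2_eq_2 singleton_iff)
  then have "h0 y \<noteq> 0" by (simp add: h0_def)
  then have "h0 \<noteq> (\<lambda>_. 0)" by metis
  ultimately have "S \<noteq> {}" using normalise by blast
  let ?E = "\<lambda>v. inner_pi (($) v) (apply_kernel (($) v))"
  have "continuous_on S ?E"
    unfolding inner_pi_def apply_kernel_def by (intro continuous_intros)
  then obtain v where v: "v \<in> S" "\<And>w. w \<in> S \<Longrightarrow> ?E w \<le> ?E v"
    using continuous_attains_sup[OF \<open>compact S\<close> \<open>S \<noteq> {}\<close>] by blast
  define f \<mu> where "f = ($) v" and "\<mu> = ?E v"
  have f: "(\<Sum>x\<in>UNIV. \<pi> x * f x) = 0" "inner_pi f f = 1"
    using v(1) by (auto simp: S_def f_def)
  define D where "D h x = \<mu> * h x - apply_kernel h x" for h x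
  \<comment> \<open>Maximality of \<open>\<mu>\<close> makes the quadratic form of
    \<open>\<mu> - P\<close> nonnegative on functions of mean zero.\<close>
  have D_nonneg: "0 \<le> inner_pi h (D h)" if h: "(\<Sum>x\<in>UNIV. \<pi> x * h x) = 0" for h
  proof (cases "h = (\<lambda>_. 0)")
    case True
    then show ?thesis by (simp add: inner_pi_def)
  next
    case False
    then obtain w where w: "w \<in> S" "\<And>x. h x = sqrt (inner_pi h h) * w $ x"
      using normalise[OF h] by blast
    let ?n = "sqrt (inner_pi h h)"
    have hw: "h = (\<lambda>x. ?n * w $ x)" using w(2) by auto
    have "inner_pi (\<lambda>x. c * g x) (D (\<lambda>x. c * g x)) =
        c * c * (\<mu> * inner_pi g g - inner_pi g (apply_kernel g))" for c g
      by (simp add: inner_pi_def D_def apply_kernel_def sum_distrib_left sum_subtractf algebra_simps)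
    then have "inner_pi h (D h) = ?n * ?n * (\<mu> * inner_pi (($) w) (($) w) - ?E w)"
      by (subst (1 2) hw)
    also have "\<dots> = ?n * ?n * (\<mu> - ?E w)"
      using w(1) by (simp add: S_def)
    also have "0 \<le> \<dots>"
      using v(2)[OF w(1)] by (intro mult_nonneg_nonneg[of "?n * ?n"]) (auto simp: \<mu>_def)
    finally show ?thesis .
  qed
  \<comment> \<open>The form vanishes at \<open>f\<close>. Moving \<open>f\<close> in the mean-zero
    direction \<open>D f\<close> has linear coefficient \<open>2 * inner_pi (D f) (D f)\<close>,
    which must then be 0.\<close>
  have "D f = (\<lambda>_. 0)"
  proof (rule ccontr)
    assume nz: "D f \<noteq> (\<lambda>_. 0)"
    let ?g = "D f"
    have g: "(\<Sum>x\<in>UNIV. \<pi> x * ?g x) = 0"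
      using f(1) by (simp add: D_def right_diff_distrib sum_subtractf mean_apply_kernel
          mult.left_commute[of _ \<mu>] flip: sum_distrib_left)
    have lin: "inner_pi u (D v) = \<mu> * inner_pi u v - inner_pi u (apply_kernel v)" for u v
      by (simp add: inner_pi_def D_def sum_distrib_left sum_subtractf algebra_simps)
    have commute: "inner_pi u v = inner_pi v u" for u v
      by (simp add: inner_pi_def mult.commute mult.left_commute)
    have sym: "inner_pi f (D ?g) = inner_pi ?g ?g"
      unfolding lin[of f ?g] lin[of ?g f] inner_pi_apply_kernel[OF assms(2), of f ?g] commute[of f ?g] ..
    have "0 \<le> 2 * t * inner_pi ?g ?g + t\<^sup>2 * inner_pi ?g (D ?g)" for t
    proof -
      have D_add: "D (\<lambda>x. f x + t * w x) = (\<lambda>x. D f x + t * D w x)" for w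
        by (rule ext) (simp add: D_def apply_kernel_def sum_distrib_left sum.distrib algebra_simps)
      have "0 \<le> inner_pi (\<lambda>x. f x + t * ?g x) (D (\<lambda>x. f x + t * ?g x))"
        using f(1) g by (intro D_nonneg)
          (simp add: distrib_left sum.distrib mult.left_commute[of _ t] flip: sum_distrib_left)
      also have "\<dots> = inner_pi f ?g + t * inner_pi f (D ?g) + t * inner_pi ?g ?g + t\<^sup>2 * inner_pi ?g (D ?g)"
        unfolding D_add by (simp add: inner_pi_def sum.distrib sum_distrib_left algebra_simps power2_eq_square)
      also have "inner_pi f ?g = 0"
        unfolding lin f(2) by (simp add: \<mu>_def f_def)
      finally show ?thesis unfolding sym by simp
    qed
    moreover have "0 < inner_pi ?g ?g" using inner_pi_pos[OF nz] .
    ultimately show False using nonneg_quadratic_linear_coeff[of "inner_pi ?g ?g"] by force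
  qed
  then have "apply_kernel f = (\<lambda>x. \<mu> * f x)"
    by (auto simp: D_def fun_eq_iff)
  moreover have "\<exists>x. f x \<noteq> 0"
    using f(2) by (auto simp: inner_pi_def intro: ccontr)
  ultimately show ?thesis using f(1) that by blast
qed

lemma kernel_charpoly_root_iff:
  "poly (kernel_charpoly P) \<mu> = 0 \<longleftrightarrow> (\<exists>f. f \<noteq> (\<lambda>_. 0) \<and> apply_kernel f = (\<lambda>x. \<mu> * f x))"
proof -
  let ?A = "\<chi> i j. (if i = j then \<mu> else 0) - P i j"
  have "poly (kernel_charpoly P) \<mu> = det ?A"
    by (simp add: kernel_charpoly_def poly_det if_distrib[of "\<lambda>p. poly p \<mu>"] cong: if_cong)
  then have "poly (kernel_charpoly P) \<mu> = 0 \<longleftrightarrow> (\<exists>v. v \<noteq> 0 \<and> ?A *v v = 0)"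
    by (simp add: det_zero_iff_kernel)
  also have "\<dots> \<longleftrightarrow> (\<exists>v::real^'v. ($) v \<noteq> (\<lambda>_. 0) \<and> apply_kernel (($) v) = (\<lambda>x. \<mu> * v $ x))"
  proof (intro ex_cong1)
    fix v :: "real ^ 'v"
    have "(?A *v v) $ i = \<mu> * v $ i - apply_kernel (($) v) i" for i
    proof -
      have "(?A *v v) $ i = (\<Sum>j\<in>UNIV. (if i = j then \<mu> * v $ j else 0) - P i j * v $ j)"
        unfolding matrix_vector_mult_def by (auto simp: left_diff_distrib intro!: sum.cong)
      then show ?thesis by (simp add: sum_subtractf apply_kernel_def)
    qed
    then show "v \<noteq> 0 \<and> ?A *v v = 0 \<longleftrightarrow>
        ($) v \<noteq> (\<lambda>_. 0) \<and> apply_kernel (($) v) = (\<lambda>x. \<mu> * v $ x)"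
      by (auto simp: vec_eq_iff fun_eq_iff)
  qed
  also have "\<dots> \<longleftrightarrow> (\<exists>f. f \<noteq> (\<lambda>_. 0) \<and> apply_kernel f = (\<lambda>x. \<mu> * f x))"
  proof safe
    fix f assume f: "f \<noteq> (\<lambda>_. 0)" "apply_kernel f = (\<lambda>x. \<mu> * f x)"
    have "($) (\<chi> x. f x) = f" by auto
    with f show "\<exists>v::real^'v. ($) v \<noteq> (\<lambda>_. 0) \<and> apply_kernel (($) v) = (\<lambda>x. \<mu> * v $ x)"
      by metis
  qed blast
  finally show ?thesis .
qed

text \<open>Simplicity of the root 1 ensures that the second entry of the eigenvalue list is not 1
  again.\<close>

lemma order_kernel_charpoly_1:
  assumes "2 \<le> CARD('v)" "C_sqrt P \<pi> < 1"
  shows "kernel_charpoly P \<noteq> 0" "order 1 (kernel_charpoly P) = 1"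
proof -
  \<comment> \<open>The \<open>\<pi>\<close>-weighted sum of the rows of \<open>X I - P\<close> is \<open>(X - 1) \<pi>\<close>; putting it in place of row \<open>k\<close>
    splits off the factor \<open>X - 1\<close>.\<close>
  define k :: 'v where "k = undefined"
  define a :: "'v \<Rightarrow> real poly ^ 'v" where
    "a i = (\<chi> j. (if i = j then [:0, 1:] else 0) - [:P i j:])" for i
  define q where "q = det (\<chi> i. if i = k then \<chi> j. [:\<pi> j:] else a i)"
  have "(\<Sum>l\<in>UNIV. [:\<pi> l:] *s a l) = [:- 1, 1:] *s (\<chi> j. [:\<pi> j:])"
  proof -
    have "(\<Sum>l\<in>UNIV. [:\<pi> l:] * ((if l = j then [:0, 1:] else 0) - [:P l j:])) = [:- 1, 1:] * [:\<pi> j:]" for j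
    proof -
      have "(\<Sum>l\<in>UNIV. [:\<pi> l:] * ((if l = j then [:0, 1:] else 0) - [:P l j:])) =
          (\<Sum>l\<in>UNIV. if l = j then [:0, \<pi> j:] else 0) - (\<Sum>l\<in>UNIV. [:\<pi> l * P l j:])"
        unfolding sum_subtractf[symmetric] by (intro sum.cong) auto
      also have "(\<Sum>l\<in>UNIV. [:\<pi> l * P l j:]) = [:\<Sum>l\<in>UNIV. \<pi> l * P l j:]"
        by (rule sum_to_poly)
      finally show ?thesis by (simp add: pi_P)
    qed
    then show ?thesis by (simp add: vec_eq_iff a_def)
  qed
  then have "[:\<pi> k:] * det (\<chi> i. a i) = [:- 1, 1:] * q"
    using det_row_combination[of k "\<lambda>l. [:\<pi> l:]" a]
      det_row_mul[of k "[:- 1, 1:]" "\<lambda>i. \<chi> j. [:\<pi> j:]" a]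
    unfolding q_def by (simp only:)
  then have eq: "[:\<pi> k:] * kernel_charpoly P = [:- 1, 1:] * q"
    by (simp only: kernel_charpoly_def a_def)
  \<comment> \<open>A kernel vector \<open>f\<close> would have mean zero by row \<open>k\<close>
    and be fixed by the kernel off \<open>k\<close>; stationarity adds the equation at
    \<open>k\<close>. Then 1 would have an eigenfunction of mean zero, against
    \<open>C_sqrt P \<pi> < 1\<close>.\<close>
  have q1: "poly q 1 \<noteq> 0"
  proof
    assume "poly q 1 = 0"
    moreover have "poly q 1 = det (\<chi> i j. if i = k then \<pi> j else (if i = j then 1 else 0) - P i j)"
      unfolding q_def poly_det by (rule arg_cong[of _ _ det]) (auto simp: vec_eq_iff a_def)
    ultimately have "det (\<chi> i j. if i = k then \<pi> j else (if i = j then 1 else 0) - P i j) = 0"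
      by (simp only:)
    then obtain v where v: "v \<noteq> 0"
      "(\<chi> i j. if i = k then \<pi> j else (if i = j then 1 else 0) - P i j) *v v = 0"
      unfolding det_zero_iff_kernel by blast
    define f where "f = ($) v"
    have row: "(\<Sum>j\<in>UNIV. (if i = k then \<pi> j else (if i = j then 1 else 0) - P i j) * f j) = 0" for i
      using arg_cong[OF v(2), of "\<lambda>w. w $ i"] by (simp add: matrix_vector_mult_def f_def)
    from row[of k] have mean: "(\<Sum>j\<in>UNIV. \<pi> j * f j) = 0" by simp
    have off: "f i - apply_kernel f i = 0" if "i \<noteq> k" for i
    proof -
      have "(\<Sum>j\<in>UNIV. (if i = j then 1 else 0) * f j) = (\<Sum>j\<in>UNIV. if i = j then f j else 0)"
        by (intro sum.cong) auto
      then show ?thesis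
        using row[of i] that by (simp add: apply_kernel_def left_diff_distrib sum_subtractf)
    qed
    have "(\<Sum>i\<in>UNIV. \<pi> i * (f i - apply_kernel f i)) = 0"
      by (simp add: right_diff_distrib sum_subtractf mean_apply_kernel)
    moreover have "(\<Sum>i\<in>UNIV. \<pi> i * (f i - apply_kernel f i)) =
        (\<Sum>i\<in>UNIV. if i = k then \<pi> k * (f k - apply_kernel f k) else 0)"
      using off by (intro sum.cong) auto
    ultimately have "f k - apply_kernel f k = 0" by simp
    with off have "f i - apply_kernel f i = 0" for i by metis
    then have "apply_kernel f = (\<lambda>x. 1 * f x)" by auto
    moreover obtain x where "f x \<noteq> 0"
      using v(1) by (auto simp: vec_eq_iff f_def)
    ultimately have "\<bar>1\<bar> \<le> C_sqrt P \<pi>"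
      using mean assms(1) by (intro eigenvalue_le_C_sqrt)
    with assms(2) show False by simp
  qed
  then have "q \<noteq> 0" by auto
  then have nz: "[:- 1, 1:] * q \<noteq> 0" by (subst mult_eq_0_iff) simp
  then show p: "kernel_charpoly P \<noteq> 0" using eq by auto
  have "order 1 (kernel_charpoly P) = order 1 ([:\<pi> k:] * kernel_charpoly P)"
    by (simp add: order_smult)
  also have "\<dots> = order 1 ([:- 1, 1:] * q)" by (simp only: eq)
  also have "\<dots> = order 1 ([:- 1, 1:] :: real poly) + order 1 q" by (rule order_mult[OF nz])
  also have "\<dots> = 1"
    using order_power_n_n[of "1::real" 1] order_0I[OF q1] by simp
  finally show "order 1 (kernel_charpoly P) = 1" .
qed

text \<open>By stationarity an eigenfunction for \<open>\<nu> \<noteq> 1\<close> has mean zero, so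
  \<open>\<nu> \<le> C_sqrt P \<pi>\<close>; the root 1 is simple, and
  \<open>second_largest_le\<close> applies.\<close>

lemma spectral_gap_ge:
  assumes "2 \<le> CARD('v)" "reversible P \<pi>" "C_sqrt P \<pi> < 1"
  shows "1 - C_sqrt P \<pi> \<le> spectral_gap P"
proof -
  let ?p = "kernel_charpoly P"
  note p = order_kernel_charpoly_1[OF assms(1,3)]
  obtain f \<mu> x where f: "apply_kernel f = (\<lambda>x. \<mu> * f x)" "(\<Sum>x\<in>UNIV. \<pi> x * f x) = 0" "f x \<noteq> 0"
    using ex_second_eigenfunction[OF assms(1,2)] by blast
  then have "\<mu> \<noteq> 1"
    using eigenvalue_le_C_sqrt[OF assms(1) f] assms(3) by auto
  have "f \<noteq> (\<lambda>_. 0)" using f(3) by auto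
  with f(1) have "poly ?p \<mu> = 0" unfolding kernel_charpoly_root_iff by blast
  then have "0 < order \<mu> ?p" using p(1) order_root by auto
  then have "{#1, \<mu>#} \<subseteq># proots ?p"
    using p \<open>\<mu> \<noteq> 1\<close> by (auto simp: subseteq_mset_def)
  then have "2 \<le> size (proots ?p)" using size_mset_mono by fastforce
  moreover have "\<nu> \<le> C_sqrt P \<pi>" if "\<nu> \<in># proots ?p" "\<nu> \<noteq> 1" for \<nu>
  proof -
    have "poly ?p \<nu> = 0" using that(1) p(1) by simp
    then obtain g where g: "g \<noteq> (\<lambda>_. 0)" "apply_kernel g = (\<lambda>x. \<nu> * g x)"
      unfolding kernel_charpoly_root_iff by blast
    have "(\<Sum>x\<in>UNIV. \<pi> x * g x) = \<nu> * (\<Sum>x\<in>UNIV. \<pi> x * g x)"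
      using mean_apply_kernel[of g] by (simp add: g(2) sum_distrib_left mult.left_commute)
    then have "(\<Sum>x\<in>UNIV. \<pi> x * g x) = 0" using that(2) by simp
    moreover obtain x where "g x \<noteq> 0" using g(1) by auto
    ultimately show ?thesis
      using eigenvalue_le_C_sqrt[OF assms(1) g(2)] by force
  qed
  ultimately have "rev (sorted_list_of_multiset (proots ?p)) ! 1 \<le> C_sqrt P \<pi>"
    using p by (intro second_largest_le[of _ 1]) auto
  then show ?thesis
    by (simp add: spectral_gap_def kernel_eigenvalues_def)
qed

end

section \<open>Congestion bounds for ergodic chains\<close>

lemma kernel_power_nonneg: "stochastic P \<Longrightarrow> 0 \<le> kernel_power P n x y"
  by (induction n arbitrary: x) (auto simp: stochastic_def intro!: sum_nonneg)

lemma stationary_kernel_power: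
  assumes "stationary P \<pi>"
  shows "(\<Sum>x\<in>UNIV. \<pi> x * kernel_power P n x y) = \<pi> y"
proof (induction n)
  case 0
  have "(\<Sum>x\<in>UNIV. \<pi> x * kernel_power P 0 x y) = (\<Sum>x\<in>UNIV. if x = y then \<pi> x else 0)"
    by (intro sum.cong) auto
  then show ?case by simp
next
  case (Suc n)
  have "(\<Sum>x\<in>UNIV. \<pi> x * kernel_power P (Suc n) x y) =
      (\<Sum>z\<in>UNIV. (\<Sum>x\<in>UNIV. \<pi> x * P x z) * kernel_power P n z y)"
    by (simp add: sum_distrib_left sum_distrib_right mult.assoc) (rule sum.swap)
  with Suc assms show ?case
    by (simp add: stationary_def)
qed

text \<open>Some state has positive mass, and irreducibility carries part of it to \<open>x\<close>
  in \<open>n\<close> steps, which leave \<open>\<pi>\<close> fixed.\<close>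

lemma stationary_pos:
  assumes "stochastic P" "irreducible_kernel P" "stationary P \<pi>"
  shows "0 < \<pi> x"
proof -
  have nonneg: "0 \<le> \<pi> z" for z using assms(3) by (simp add: stationary_def)
  have "sum \<pi> UNIV \<noteq> 0" using assms(3) by (simp add: stationary_def)
  then obtain z where "\<pi> z \<noteq> 0" by (meson sum.neutral)
  with nonneg have z: "0 < \<pi> z" by (simp add: order.strict_iff_order)
  obtain n where "0 < kernel_power P n z x"
    using assms(2) unfolding irreducible_kernel_def by blast
  with z have "0 < \<pi> z * kernel_power P n z x" by simp
  also have "\<dots> \<le> (\<Sum>y\<in>UNIV. \<pi> y * kernel_power P n y x)"
    using nonneg kernel_power_nonneg[OF assms(1)] by (intro member_le_sum) auto
  also have "\<dots> = \<pi> x" by (rule stationary_kernel_power[OF assms(3)])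
  finally show ?thesis .
qed

context lazy_positive_chain
begin

lemma flow_bound_mono:
  assumes "flow_bound r e" "r \<le> r'"
  shows "flow_bound r' e"
  unfolding flow_bound_def
proof (intro allI impI)
  fix A :: "'v set"
  assume "A \<noteq> {}" "A \<noteq> UNIV"
  then obtain F where F: "\<And>y. y \<notin> A \<Longrightarrow> F y \<le> r * \<pi> y" "\<And>y. y \<notin> A \<Longrightarrow> F y \<le> e * ergodic_flow P \<pi> A y"
      "sum F (- A) = sum \<pi> A * (1 - sum \<pi> A)"
    using flow_boundE[OF assms(1)] by blast
  have "F y \<le> r' * \<pi> y" if "y \<notin> A" for y
    using F(1)[OF that] mult_right_mono[OF assms(2) pi_nonneg[of y]] by linarith
  with F(2,3) show "\<exists>F. (\<forall>y\<in>- A. F y \<le> r' * \<pi> y \<and> F y \<le> e * ergodic_flow P \<pi> A y) \<and>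
      sum F (- A) = sum \<pi> A * (1 - sum \<pi> A)"
    by blast
qed

text \<open>The weaker lower bound for the gap is already positive; this gives the strict inequality
  that the spectral argument requires.\<close>

lemma gap_formula_flow_bound:
  assumes "flow_bound r e" "2 \<le> CARD('v)"
  shows "1 / (4 * r * e) \<le> 2 * (r / e) * (1 - sqrt (1 - 1 / (4 * r\<^sup>2)))"
    and "C_sqrt P \<pi> < 1"
proof -
  obtain v where v: "\<pi> v \<le> 1 / 2" using ex_light_state[OF assms(2)] by blast
  then have re: "1 / 2 \<le> r" "1 \<le> e"
    using flow_bound_lower[OF assms, of v] by auto
  then show *: "1 / (4 * r * e) \<le> 2 * (r / e) * (1 - sqrt (1 - 1 / (4 * r\<^sup>2)))"
    by (intro gap_formula_ge) auto
  moreover have "0 < 1 / (4 * r * e)" using re by simp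
  ultimately show "C_sqrt P \<pi> < 1"
    using C_sqrt_flow_bound[OF assms] by linarith
qed

end

theorem corollary4p4p4:
  fixes P :: "'v::finite \<Rightarrow> 'v \<Rightarrow> real"
    and \<pi> :: "'v \<Rightarrow> real"
    and \<Gamma> :: "'v \<Rightarrow> 'v \<Rightarrow> ('v \<times> 'v) list"
  assumes "2 \<le> CARD('v)"
    and "ergodic_chain P"
    and "lazy_chain P"
    and "stationary P \<pi>"
    and "path_system P \<Gamma>"
  shows
    "(let \<rho>e = rho_e P \<pi> \<Gamma>; \<rho>v = rho_v \<pi> \<Gamma> in
        1 - C_sqrt P \<pi> \<ge> 2 * (\<rho>v / \<rho>e) * (1 - sqrt (1 - 1 / (4 * \<rho>v\<^sup>2))) \<and>
        2 * (\<rho>v / \<rho>e) * (1 - sqrt (1 - 1 / (4 * \<rho>v\<^sup>2))) \<ge> 1 / (4 * \<rho>v * \<rho>e) \<and>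
        (\<forall>\<epsilon>>0. 2 * \<epsilon> * sqrt (pi_min \<pi>) \<le> 1 \<longrightarrow>
           real (mixing_time P \<pi> \<epsilon>) \<le> 4 * \<rho>v * \<rho>e * ln (1 / (2 * \<epsilon> * sqrt (pi_min \<pi>))))) \<and>
     (reversible P \<pi> \<longrightarrow>
        spectral_gap P \<ge> 1 - C_sqrt P \<pi> \<and>
        (\<forall>\<Delta>. undirected_path_system P \<Delta> \<longrightarrow>
           (let \<rho>e = undirected_rho_e P \<pi> \<Delta>; \<rho>v = undirected_rho_v \<pi> \<Delta> in
              1 - C_sqrt P \<pi> \<ge> 2 * (\<rho>v / \<rho>e) * (1 - sqrt (1 - 1 / (4 * \<rho>v\<^sup>2))) \<and>
              2 * (\<rho>v / \<rho>e) * (1 - sqrt (1 - 1 / (4 * \<rho>v\<^sup>2))) \<ge> 1 / (4 * \<rho>v * \<rho>e) \<and>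
              (\<forall>\<epsilon>>0. 2 * \<epsilon> * sqrt (pi_min \<pi>) \<le> 1 \<longrightarrow>
                 int (mixing_time P \<pi> \<epsilon>) \<le>
                   \<lceil>4 * \<rho>v * \<rho>e * ln (1 / (2 * \<epsilon> * sqrt (pi_min \<pi>)))\<rceil>))))"
proof -
  have "stochastic P" "irreducible_kernel P"
    using assms(2) by (auto simp: ergodic_chain_def)
  then interpret lazy_positive_chain P \<pi>
    using assms(3,4) stationary_pos by unfold_locales auto
  \<comment> \<open>The lowered vertex constant serves the mixing time; the gap estimates use its
    weakening \<open>flow'\<close>.\<close>
  have flow: "flow_bound (rho_v \<pi> \<Gamma> - 1 / 2) (rho_e P \<pi> \<Gamma>)"
    by (rule flow_bound_directed[OF assms(5,1)])
  then have flow': "flow_bound (rho_v \<pi> \<Gamma>) (rho_e P \<pi> \<Gamma>)"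
    by (rule flow_bound_mono) simp
  show ?thesis
    unfolding Let_def
    using C_sqrt_flow_bound[OF flow' assms(1)] gap_formula_flow_bound[OF flow' assms(1)]
      mixing_time_flow_bound_rounded[OF flow assms(1) rho_v_ge_endpoints[OF assms(5)]]
      spectral_gap_ge[OF assms(1)]
      C_sqrt_flow_bound[OF flow_bound_undirected assms(1)]
      gap_formula_flow_bound(1)[OF flow_bound_undirected assms(1)]
      mixing_time_flow_bound[OF flow_bound_undirected assms(1)]
    by (intro conjI allI impI) simp_all
qed

end
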